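(* Let $f:\mathbb{R}^d\to\mathbb{R}$ be convex (Assumption A below), $(H_0,H_1)$-smooth (Assumption B below), with a stochastic gradient oracle satisfying Assumption C below. Let $\rho\in(0,1)$, $\Delta>0$, let $Q\subset\mathbb{R}^d$ be a closed convex set with $w,x^\star\in Q$ and $D=\operatorname{diam}(Q)\in(0,\infty)$, and suppose $F(w)\le\Delta$. Run the phase procedure RCSAG-Phase described in the context from $w$ with the phase parameters $\Lambda,T,a$ given there. Then its output $y_T$ satisfies $$\mathbb{P}\{F(y_T)\le\Delta/2\}\ge 1-\rho .$$
   Context: Setting. $\|\cdot\|$ is the Euclidean norm on $\mathbb{R}^d$, $f^\star=\min f$, the set of minimizers of $f$ is nonempty, $x^\star$ is a fixed minimizer, $F(x)=f(x)-f^\star$. Assumption A (convexity). $f$ is differentiable and, for some $\mu\ge0$, $f(y)\ge f(x)+\langle\nabla f(x),y-x\rangle+\frac{\mu}{2}\|y-x\|^2$ for all $x,y$. Assumption B ($(H_0,H_1)$-smoothness). $H_0,H_1\ge0$; $r_H:=((2\sqrt3+\sqrt6)\sqrt{H_1})^{-1}$ if $H_1>0$ and $r_H:=\infty$ if $H_1=0$; for all $x,y$ with $\|y-x\|\le r_H$, $f(y)\le f(x)+\langle\nabla f(x),y-x\rangle+(H_0+H_1F(x))\|y-x\|^2$. Assumption C (oracle). $1<p\le2$ and $\sigma_0,\sigma_1,\sigma_2\ge0$. Let $\mathcal F_t$ be the filtration generated by the samples through iteration $t$ and $\mathbb{E}_t[\cdot]=\mathbb{E}[\cdot\mid\mathcal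 F_{t-1}]$. For every $\mathcal F_{t-1}$-measurable query $x$, a fresh sample gives $g(x,\xi_t)$ with $\mathbb{E}_t[g(x,\xi_t)]=\nabla f(x)$ and $\mathbb{E}_t\|g(x,\xi_t)-\nabla f(x)\|^p\le\sigma_0^p+\sigma_1^p\|\nabla f(x)\|^p+\sigma_2^pF(x)^{p/2}$. Phase parameters. $C_\star=19+12\sqrt2$ if $H_1>0$, $C_\star=2$ if $H_1=0$; $\mathcal H_\Delta=H_0+H_1\Delta$; $G_\Delta=\sqrt{32C_\star\Delta\mathcal H_\Delta}$; $\varsigma_{p,\Delta}^p=\sigma_0^p+\sigma_1^pG_\Delta^p+\sigma_2^p(4\Delta)^{p/2}$; $\Lambda=\max\{2G_\Delta,(64\varsigma_{p,\Delta}^pD/\Delta)^{1/(p-1)}\}$; $R=D\Lambda/\Delta$; $T=\lceil1024(1+R)\log(8/\rho)\rceil$; $a=5D^2/(\Delta T)$. Clipping: $\operatorname{clip}_\Lambda(v)=v\min\{1,\Lambda/\|v\|\}$, with $\operatorname{clip}_\Lambda(0)=0$ (and $\operatorname{clip}_0\equiv0$). $\Pi_Q$ is Euclidean projection onto $Q$. RCSAG-Phase. Set $y_0=z_0=w$, $A_0=D^2/\Delta$, $A_t=A_0+ta$. For $t=1,\dots,T$: $u_t=(A_{t-1}y_{t-1}+az_{t-1})/A_t$; query $g_t=g(u_t,\xi_t)$ using one fresh sample; $\widehat g_t=\operatorname{clip}_\Lambda(g_t)$; $z_t=\Pi_Q(z_{t-1}-a\widehat g_t)$; $y_t=(A_{t-1}y_{t-1}+az_t)/A_t$.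 Return $y_T$. *)

theory Defs
  imports "HOL-Probability.Probability"
begin

section \<open>Objective function\<close>

text \<open>The theorem assumes that a minimizer exists, so the infimum below is the minimum of \<open>f\<close>.\<close>

definition opt_gap :: "('a \<Rightarrow> real) \<Rightarrow> 'a \<Rightarrow> real" where
  "opt_gap f x = f x - (INF y. f y)"

definition convex_differentiable ::
    "('a::euclidean_space \<Rightarrow> real) \<Rightarrow> ('a \<Rightarrow> 'a) \<Rightarrow> real \<Rightarrow> bool" where
  "convex_differentiable f grad \<mu> \<longleftrightarrow>
     0 \<le> \<mu> \<and>
     (\<forall>x. GDERIV f x :> grad x) \<and>
     (\<forall>x y. f y \<ge> f x + grad x \<bullet> (y - x) + \<mu> / 2 * (norm (y - x))\<^sup>2)"

definition smoothness_radius :: "real \<Rightarrow> ereal" where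
  "smoothness_radius H1 =
     (if H1 > 0 then ereal (inverse ((2 * sqrt 3 + sqrt 6) * sqrt H1)) else \<infinity>)"

definition H_smooth ::
    "('a::euclidean_space \<Rightarrow> real) \<Rightarrow> ('a \<Rightarrow> 'a) \<Rightarrow> real \<Rightarrow> real \<Rightarrow> bool" where
  "H_smooth f grad H0 H1 \<longleftrightarrow>
     0 \<le> H0 \<and> 0 \<le> H1 \<and>
     (\<forall>x y. ereal (norm (y - x)) \<le> smoothness_radius H1 \<longrightarrow>
        f y \<le> f x + grad x \<bullet> (y - x) + (H0 + H1 * opt_gap f x) * (norm (y - x))\<^sup>2)"


section \<open>Stochastic gradient oracle\<close>

text \<open>Samples are indexed from 1, so the filtration at time 0 is the trivial sigma-algebra.\<close>

definition sample_filtration ::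
    "'b measure \<Rightarrow> 'c measure \<Rightarrow> (nat \<Rightarrow> 'b \<Rightarrow> 'c) \<Rightarrow> nat \<Rightarrow> 'b measure" where
  "sample_filtration M S \<xi> t =
     sigma (space M) (\<Union>s\<in>{1..t}. {\<xi> s -` A \<inter> space M | A. A \<in> sets S})"

text \<open>
  The conditional expectation of the vector-valued gradient is taken coordinatewise.  The moment
  bound is stated with the extended nonnegative conditional expectation, so it really asserts
  finiteness.  As \<open>p > 1\<close>, it makes the conditional expectations of the positive and negative parts
  of every coordinate finite almost surely; hence \<^const>\<open>real_cond_exp\<close> is the genuine conditional
  mean even for a query at which the stochastic gradient is not integrable over the whole space.
\<close>

definition stochastic_oracle ::
    "'b measure \<Rightarrow> 'c measure \<Rightarrow> (nat \<Rightarrow> 'b \<Rightarrow> 'c) \<Rightarrow> ('a::euclidean_space \<Rightarrow> 'c \<Rightarrow> 'a) \<Rightarrow>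
     ('a \<Rightarrow> real) \<Rightarrow> ('a \<Rightarrow> 'a) \<Rightarrow> real \<Rightarrow> real \<Rightarrow> real \<Rightarrow> real \<Rightarrow> bool" where
  "stochastic_oracle M S \<xi> g f grad p \<sigma>0 \<sigma>1 \<sigma>2 \<longleftrightarrow>
     1 < p \<and> p \<le> 2 \<and> 0 \<le> \<sigma>0 \<and> 0 \<le> \<sigma>1 \<and> 0 \<le> \<sigma>2 \<and>
     (\<forall>t\<ge>1. \<xi> t \<in> measurable M S) \<and>
     (\<lambda>(x, s). g x s) \<in> borel_measurable (borel \<Otimes>\<^sub>M S) \<and>
     (\<forall>t\<ge>1. \<forall>x \<in> borel_measurable (sample_filtration M S \<xi> (t - 1)).
        (\<forall>b\<in>Basis. AE \<omega> in M.
           real_cond_exp M (sample_filtration M S \<xi> (t - 1)) (\<lambda>\<omega>. g (x \<omega>) (\<xi> t \<omega>) \<bullet> b) \<omega>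
             = grad (x \<omega>) \<bullet> b) \<and>
        (AE \<omega> in M.
           nn_cond_exp M (sample_filtration M S \<xi> (t - 1))
               (\<lambda>\<omega>. ennreal (norm (g (x \<omega>) (\<xi> t \<omega>) - grad (x \<omega>)) powr p)) \<omega>
             \<le> ennreal (\<sigma>0 powr p + \<sigma>1 powr p * norm (grad (x \<omega>)) powr p
                          + \<sigma>2 powr p * opt_gap f (x \<omega>) powr (p / 2))))"


section \<open>Phase parameters\<close>

definition C_star :: "real \<Rightarrow> real" where
  "C_star H1 = (if H1 > 0 then 19 + 12 * sqrt 2 else 2)"

definition local_smoothness :: "real \<Rightarrow> real \<Rightarrow> real \<Rightarrow> real" where
  "local_smoothness H0 H1 \<Delta> = H0 + H1 * \<Delta>"

definition grad_bound :: "real \<Rightarrow> real \<Rightarrow> real \<Rightarrow> real" where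
  "grad_bound H0 H1 \<Delta> = sqrt (32 * C_star H1 * \<Delta> * local_smoothness H0 H1 \<Delta>)"

text \<open>This is the \<open>p\<close>-th power of the noise level, the only form in which that level is used.\<close>

definition noise_pow ::
    "real \<Rightarrow> real \<Rightarrow> real \<Rightarrow> real \<Rightarrow> real \<Rightarrow> real \<Rightarrow> real \<Rightarrow> real" where
  "noise_pow H0 H1 p \<sigma>0 \<sigma>1 \<sigma>2 \<Delta> =
     \<sigma>0 powr p + \<sigma>1 powr p * grad_bound H0 H1 \<Delta> powr p + \<sigma>2 powr p * (4 * \<Delta>) powr (p / 2)"

definition clip_level ::
    "real \<Rightarrow> real \<Rightarrow> real \<Rightarrow> real \<Rightarrow> real \<Rightarrow> real \<Rightarrow> real \<Rightarrow> real \<Rightarrow> real" where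
  "clip_level H0 H1 p \<sigma>0 \<sigma>1 \<sigma>2 \<Delta> D =
     max (2 * grad_bound H0 H1 \<Delta>)
         ((64 * noise_pow H0 H1 p \<sigma>0 \<sigma>1 \<sigma>2 \<Delta> * D / \<Delta>) powr (1 / (p - 1)))"

definition phase_length :: "real \<Rightarrow> real \<Rightarrow> real \<Rightarrow> real \<Rightarrow> nat" where
  "phase_length \<Lambda> \<Delta> D \<rho> = (let R = D * \<Lambda> / \<Delta> in nat \<lceil>1024 * (1 + R) * ln (8 / \<rho>)\<rceil>)"

definition phase_step :: "real \<Rightarrow> real \<Rightarrow> nat \<Rightarrow> real" where
  "phase_step \<Delta> D T = 5 * D\<^sup>2 / (\<Delta> * real T)"


section \<open>The phase procedure\<close>

definition clip :: "real \<Rightarrow> 'a::real_normed_vector \<Rightarrow> 'a" where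
  "clip \<Lambda> v = (if v = 0 then 0 else min 1 (\<Lambda> / norm v) *\<^sub>R v)"

definition phase_weight :: "real \<Rightarrow> real \<Rightarrow> real \<Rightarrow> nat \<Rightarrow> real" where
  "phase_weight \<Delta> D a t = D\<^sup>2 / \<Delta> + real t * a"

text \<open>The pair \<open>(y\<^sub>t, z\<^sub>t)\<close> along one realization \<open>s\<close> of the sample sequence.\<close>

primrec phase_iterates ::
    "('a::euclidean_space \<Rightarrow> 'c \<Rightarrow> 'a) \<Rightarrow> 'a set \<Rightarrow> 'a \<Rightarrow> real \<Rightarrow> real \<Rightarrow> real \<Rightarrow> real \<Rightarrow>
     (nat \<Rightarrow> 'c) \<Rightarrow> nat \<Rightarrow> 'a \<times> 'a" where
  "phase_iterates g Q w \<Delta> D \<Lambda> a s 0 = (w, w)"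
| "phase_iterates g Q w \<Delta> D \<Lambda> a s (Suc t) =
     (let (y, z) = phase_iterates g Q w \<Delta> D \<Lambda> a s t;
          A = phase_weight \<Delta> D a t;
          A' = phase_weight \<Delta> D a (Suc t);
          u = (A *\<^sub>R y + a *\<^sub>R z) /\<^sub>R A';
          z' = closest_point Q (z - a *\<^sub>R clip \<Lambda> (g u (s (Suc t))));
          y' = (A *\<^sub>R y + a *\<^sub>R z') /\<^sub>R A'
      in (y', z'))"

definition rcsag_phase ::
    "('a::euclidean_space \<Rightarrow> 'c \<Rightarrow> 'a) \<Rightarrow> 'a set \<Rightarrow> 'a \<Rightarrow> real \<Rightarrow> real \<Rightarrow> real \<Rightarrow> nat \<Rightarrow> real \<Rightarrow>
     (nat \<Rightarrow> 'c) \<Rightarrow> 'a" where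
  "rcsag_phase g Q w \<Delta> D \<Lambda> T a s = fst (phase_iterates g Q w \<Delta> D \<Lambda> a s T)"

end

theory Submission
  imports Defs
begin

text \<open>
  Let \<open>F\<close> be the optimality gap. The proof follows the accelerated potential
  \<open>A_t * F(y_t) + (norm (z_t - xstar))^2 / 2\<close>, which is at most \<open>3/2 * D^2\<close> at the start. The final
  weight is \<open>6 * D^2 / \<Delta>\<close>, so it suffices that the potential stays below \<open>3 * D^2\<close> with high
  probability.

  As long as it does, \<open>F(y_t) \<le> 3 * \<Delta>\<close>. The step ratio \<open>a / A_t\<close> is of order \<open>1 / T\<close>, so
  the displacements from \<open>y_t\<close> to the query and from the query to the next \<open>y\<close> are short compared
  with the smoothness radius, and the query has \<open>F \<le> 4 * \<Delta>\<close>. There the gradient is bounded by half the clipping level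
  (\<open>norm_grad_le_grad_bound\<close>) and the oracle noise by a constant. The usual acceleration argument
  (\<open>potential_step\<close>) then shows that the potential grows by at most
  \<open>a * ((grad - clipped) \<bullet> (z - xstar)) + a^2 * (norm (clipped - grad))^2\<close> per step.

  These increments are bounded because of the clipping, so a suitable multiple \<open>x\<close> satisfies
  \<open>exp x \<le> 1 + x + x^2\<close>. Two pointwise estimates for clipping charge its bias and
  its second moment to the \<open>p\<close>-th power of the noise, and what remains is linear in the unclipped
  noise (\<open>exp_increment_le\<close>). Taking expectations, the linear term vanishes and the \<open>p\<close>-th power
  contributes a factor at most \<open>exp (l / (4 * T))\<close>, where \<open>l = ln (8 / \<rho>)\<close>.

  Since the bounds hold only below the threshold, the argument is applied to the potential frozen at
  the first time it exceeds \<open>3 * D^2\<close>. Its exponential moment at time \<open>T\<close> is at most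
  \<open>exp (3/2 * l + l/4)\<close>, and Markov's inequality at the level \<open>exp (3 * l)\<close> bounds the failure
  probability by \<open>\<rho> / 8\<close>.
\<close>

section \<open>Gradients under gap-dependent smoothness\<close>

lemma real_affine_bounded_above_imp_slope_nonpos:
  fixes n F :: real
  assumes "\<And>r. 0 \<le> r \<Longrightarrow> n * r \<le> F"
  shows "n \<le> 0"
proof (rule ccontr)
  assume n: "\<not> n \<le> 0"
  have "0 \<le> F" using assms[of 0] by simp
  then have "n * ((F + 1) / n) \<le> F" using n by (intro assms) auto
  then show False using n by simp
qed

locale smooth_convex_objective =
  fixes f :: "'a::euclidean_space \<Rightarrow> real" and grad :: "'a \<Rightarrow> 'a"
    and \<mu> H0 H1 :: real and xstar :: 'a
  assumes minimizer: "f xstar \<le> f x"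
    and convex_differentiable: "convex_differentiable f grad \<mu>"
    and H_smooth: "H_smooth f grad H0 H1"
begin

lemma H0_nonneg: "0 \<le> H0" and H1_nonneg: "0 \<le> H1"
  using H_smooth unfolding H_smooth_def by auto

lemma C_star_pos: "0 < C_star H1"
  by (simp add: C_star_def add_pos_nonneg)

lemma two_le_C_star: "2 \<le> C_star H1"
  by (simp add: C_star_def)

lemma opt_gap_eq: "opt_gap f x = f x - f xstar"
proof -
  have "(INF y. f y) = f xstar"
    by (rule cInf_eq_minimum) (use minimizer in auto)
  then show ?thesis by (simp add: opt_gap_def)
qed

lemma opt_gap_nonneg: "0 \<le> opt_gap f x"
  using minimizer[of x] by (simp add: opt_gap_eq)

lemma opt_gap_xstar: "opt_gap f xstar = 0"
  by (simp add: opt_gap_eq)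

lemma opt_gap_convex_lower:
  "opt_gap f x + grad x \<bullet> (y - x) \<le> opt_gap f y"
proof -
  have "0 \<le> \<mu> / 2 * (norm (y - x))\<^sup>2"
    using convex_differentiable unfolding convex_differentiable_def by simp
  moreover have "f x + grad x \<bullet> (y - x) + \<mu> / 2 * (norm (y - x))\<^sup>2 \<le> f y"
    using convex_differentiable unfolding convex_differentiable_def by auto
  ultimately show ?thesis by (simp add: opt_gap_eq)
qed

lemma opt_gap_smooth_upper:
  assumes "ereal (norm (y - x)) \<le> smoothness_radius H1"
  shows "opt_gap f y \<le> opt_gap f x + grad x \<bullet> (y - x)
           + (H0 + H1 * opt_gap f x) * (norm (y - x))\<^sup>2"
  using H_smooth assms unfolding H_smooth_def by (force simp: opt_gap_eq)

text \<open>
  Moving a distance \<open>r\<close> against the gradient cannot push the gap below zero. Keeping \<open>r\<close>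
  free, rather than fixing the step \<open>norm (grad x) / (2 * L)\<close>, also covers gradients so large
  that this step leaves the smoothness radius.
\<close>
lemma grad_descent:
  assumes "0 \<le> r" and r: "ereal r \<le> smoothness_radius H1"
  shows "norm (grad x) * r \<le> opt_gap f x + (H0 + H1 * opt_gap f x) * r\<^sup>2"
proof (cases "grad x = 0")
  case True
  then show ?thesis
    using opt_gap_nonneg[of x] H0_nonneg H1_nonneg by (simp add: add_nonneg_nonneg)
next
  case False
  define y where "y = x - (r / norm (grad x)) *\<^sub>R grad x"
  have n: "norm (y - x) = r"
    using False \<open>0 \<le> r\<close> by (simp add: y_def)
  have "grad x \<bullet> (y - x) = - (norm (grad x) * r)"
    using False by (simp add: y_def power2_norm_eq_inner[symmetric] power2_eq_square)
  then show ?thesis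
    using opt_gap_smooth_upper[of y x] n r opt_gap_nonneg[of y] by simp
qed

text \<open>
  The square of \<open>2 * sqrt 3 + sqrt 6\<close> is \<open>18 + 12 * sqrt 2\<close>, which is why \<^const>\<open>C_star\<close>
  exceeds by one the constant that converts the squared radius into \<open>1 / H1\<close>.
\<close>
lemma smoothness_radius_sq:
  assumes "H1 > 0"
  shows "(inverse ((2 * sqrt 3 + sqrt 6) * sqrt H1))\<^sup>2 * ((C_star H1 - 1) * H1) = 1"
proof -
  have "sqrt 3 * sqrt 6 = 3 * sqrt (2::real)"
  proof -
    have "sqrt 3 * sqrt 6 = sqrt (9 * 2 :: real)" by (simp flip: real_sqrt_mult)
    also have "\<dots> = 3 * sqrt 2" by (subst real_sqrt_mult) simp
    finally show ?thesis .
  qed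
  then have "(2 * sqrt 3 + sqrt 6)\<^sup>2 = C_star H1 - 1"
    using assms by (simp add: C_star_def power2_sum power_mult_distrib algebra_simps)
  moreover have "0 < C_star H1 - 1"
    using two_le_C_star by simp
  ultimately have "((2 * sqrt 3 + sqrt 6) * sqrt H1)\<^sup>2 = (C_star H1 - 1) * H1"
    and "(C_star H1 - 1) * H1 \<noteq> 0"
    using assms by (auto simp: power_mult_distrib)
  then show ?thesis
    by (simp only: power_inverse left_inverse not_False_eq_True)
qed

lemma smoothness_radius_ge:
  assumes "0 \<le> r" and "C_star H1 * H1 * r\<^sup>2 \<le> 1"
  shows "ereal r \<le> smoothness_radius H1"
proof (cases "H1 > 0")
  case True
  define r0 where "r0 = inverse ((2 * sqrt 3 + sqrt 6) * sqrt H1)"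
  have r0: "0 < r0" unfolding r0_def using True by (simp add: add_pos_pos)
  have pos: "0 < (C_star H1 - 1) * H1" using two_le_C_star True by simp
  have "r\<^sup>2 * ((C_star H1 - 1) * H1) \<le> C_star H1 * H1 * r\<^sup>2"
    using True by (simp add: algebra_simps)
  also have "\<dots> \<le> r0\<^sup>2 * ((C_star H1 - 1) * H1)"
    using assms smoothness_radius_sq[OF True] by (simp add: r0_def)
  finally have "r\<^sup>2 \<le> r0\<^sup>2" using pos by (rule mult_right_le_imp_le)
  then have "r \<le> r0" by (rule power2_le_imp_le) (use r0 in simp)
  then show ?thesis using True by (simp add: smoothness_radius_def r0_def)
next
  case False
  then show ?thesis by (simp add: smoothness_radius_def)
qed

text \<open>
  With \<open>L\<close> the local constant, the ideal step \<open>norm (grad x) / (2 * L)\<close> gives the classical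
  bound \<open>4 * L * F\<close>. If that step is too long, stepping to the boundary of the radius \<open>r0\<close> gives
  \<open>n * r0 \<le> F + L * r0^2\<close> together with \<open>L * r0^2 \<le> F\<close>; squaring, and using
  \<open>F / r0^2 = (C - 1) * H1 * F \<le> (C - 1) * L\<close> with \<open>C = C_star H1\<close>, leaves
  \<open>(C + 2) * L * F \<le> 2 * C * L * F\<close>.
\<close>
lemma norm_grad_sq_le:
  "(norm (grad x))\<^sup>2 \<le> 2 * C_star H1 * (H0 + H1 * opt_gap f x) * opt_gap f x"
proof -
  define n F L where "n = norm (grad x)" and "F = opt_gap f x" and "L = H0 + H1 * F"
  have n: "0 \<le> n" and F: "0 \<le> F" and L: "0 \<le> L"
    using opt_gap_nonneg H0_nonneg H1_nonneg by (auto simp: n_def F_def L_def)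
  have desc: "n * r \<le> F + L * r\<^sup>2" if "0 \<le> r" "ereal r \<le> smoothness_radius H1" for r
    using grad_descent[OF that] by (simp add: n_def F_def L_def)
  have "n\<^sup>2 \<le> 2 * C_star H1 * L * F"
  proof (cases "0 < L \<and> ereal (n / (2 * L)) \<le> smoothness_radius H1")
    case True
    then have "n * (n / (2 * L)) \<le> F + L * (n / (2 * L))\<^sup>2"
      using n by (intro desc) auto
    then have "n\<^sup>2 \<le> 4 * (L * F)"
      using True by (simp add: field_simps power2_eq_square)
    also have "\<dots> \<le> (2 * C_star H1) * (L * F)"
      using two_le_C_star L F by (intro mult_right_mono) auto
    finally show ?thesis by (simp add: mult.assoc)
  next
    case False
    show ?thesis
    proof (cases "H1 > 0")
      case True
      define r0 where "r0 = inverse ((2 * sqrt 3 + sqrt 6) * sqrt H1)"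
      have r0: "0 < r0" unfolding r0_def using True by (simp add: add_pos_pos)
      have rad: "smoothness_radius H1 = ereal r0"
        using True by (simp add: smoothness_radius_def r0_def)
      have d: "n * r0 \<le> F + L * r0\<^sup>2" using desc[of r0] r0 rad by simp
      have "2 * L * r0 \<le> n"
      proof (cases "0 < L")
        case True
        then show ?thesis using False rad by (simp add: field_simps)
      qed (use L n in auto)
      then have "2 * L * r0 * r0 \<le> n * r0"
        using r0 by (intro mult_right_mono) auto
      then have Lr: "L * r0\<^sup>2 \<le> F" using d by (simp add: power2_eq_square)
      have sq: "r0\<^sup>2 * ((C_star H1 - 1) * H1) = 1"
        using smoothness_radius_sq[OF True] by (simp add: r0_def)
      have "(n * r0)\<^sup>2 \<le> (F + L * r0\<^sup>2)\<^sup>2"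
        using d n r0 by (intro power_mono) auto
      also have "\<dots> = F * F + 2 * F * (L * r0\<^sup>2) + (L * r0\<^sup>2) * (L * r0\<^sup>2)"
        by (simp add: power2_eq_square algebra_simps)
      also have "\<dots> \<le> F * F + 2 * F * (L * r0\<^sup>2) + F * (L * r0\<^sup>2)"
        using Lr L by (intro add_left_mono mult_right_mono) auto
      also have "F * F = r0\<^sup>2 * ((C_star H1 - 1) * (H1 * F)) * F"
        using sq by (simp add: mult.assoc[symmetric])
      also have "\<dots> \<le> r0\<^sup>2 * ((C_star H1 - 1) * L) * F"
        using two_le_C_star F H0_nonneg by (intro mult_right_mono mult_left_mono) (auto simp: L_def)
      finally have "r0\<^sup>2 * n\<^sup>2 \<le> r0\<^sup>2 * ((C_star H1 + 2) * (L * F))"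
        by (simp add: power_mult_distrib algebra_simps)
      then have "n\<^sup>2 \<le> (C_star H1 + 2) * (L * F)"
        using r0 by simp
      also have "\<dots> \<le> (2 * C_star H1) * (L * F)"
        using two_le_C_star L F by (intro mult_right_mono) auto
      finally show ?thesis by (simp add: mult.assoc)
    next
      case H1: False
      then have rad: "smoothness_radius H1 = \<infinity>" by (simp add: smoothness_radius_def)
      then have "L = 0" using False L by auto
      then have "n * r \<le> F" if "0 \<le> r" for r using desc[OF that] rad by simp
      then have "n \<le> 0" by (rule real_affine_bounded_above_imp_slope_nonpos)
      then show ?thesis using n \<open>L = 0\<close> by simp
    qed
  qed
  then show ?thesis by (simp add: n_def F_def L_def)
qed

text \<open>
  The phase keeps every query at gap at most \<open>4 * \<Delta>\<close>, where the local constant is at most four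
  times its value at gap \<open>\<Delta>\<close>; this is the origin of the factor 32 in \<^const>\<open>grad_bound\<close>.
\<close>
lemma norm_grad_le_grad_bound:
  assumes "opt_gap f x \<le> 4 * \<Delta>" and "0 < \<Delta>"
  shows "norm (grad x) \<le> grad_bound H0 H1 \<Delta>"
proof -
  have "(norm (grad x))\<^sup>2 \<le> (2 * C_star H1) * (H0 + H1 * opt_gap f x) * opt_gap f x"
    using norm_grad_sq_le[of x] by simp
  also have "\<dots> \<le> (2 * C_star H1) * (4 * (H0 + H1 * \<Delta>)) * (4 * \<Delta>)"
  proof (intro mult_mono mult_left_mono)
    have "H1 * opt_gap f x \<le> H1 * (4 * \<Delta>)"
      using assms H1_nonneg by (intro mult_left_mono) auto
    then show "H0 + H1 * opt_gap f x \<le> 4 * (H0 + H1 * \<Delta>)"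
      using H0_nonneg by (simp add: algebra_simps)
  qed (use assms opt_gap_nonneg H0_nonneg H1_nonneg C_star_pos in auto)
  also have "\<dots> = 32 * C_star H1 * \<Delta> * local_smoothness H0 H1 \<Delta>"
    by (simp add: local_smoothness_def)
  finally show ?thesis
    unfolding grad_bound_def by (rule real_le_rsqrt)
qed

lemma continuous_objective: "continuous_on UNIV f"
proof -
  have "isCont f x" for x
    using convex_differentiable has_derivative_continuous
    unfolding convex_differentiable_def gderiv_def by blast
  then show ?thesis by (simp add: continuous_on_eq_continuous_at)
qed

lemma borel_measurable_objective [measurable]: "f \<in> borel_measurable borel"
  using continuous_objective by (rule borel_measurable_continuous_onI)

lemma borel_measurable_opt_gap [measurable]: "opt_gap f \<in> borel_measurable borel"
proof -
  have "opt_gap f = (\<lambda>x. f x - f xstar)" by (rule ext) (rule opt_gap_eq)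
  then show ?thesis by simp
qed

text \<open>
  Each coordinate is a pointwise limit of difference quotients of the continuous function
  \<^term>\<open>f\<close>.
\<close>
lemma borel_measurable_grad [measurable]: "grad \<in> borel_measurable borel"
proof (subst borel_measurable_euclidean_space, intro ballI)
  fix b :: 'a assume "b \<in> Basis"
  let ?q = "\<lambda>n x. real (Suc n) * (f (x + (1 / real (Suc n)) *\<^sub>R b) - f x)"
  have lim: "(\<lambda>n. ?q n x) \<longlonglongrightarrow> grad x \<bullet> b" for x
  proof -
    have fd: "(f has_derivative (\<lambda>h. h \<bullet> grad x)) (at x)"
      using convex_differentiable unfolding convex_differentiable_def gderiv_def by blast
    have "((\<lambda>h. f (x + h *\<^sub>R b)) has_derivative (\<lambda>h. (h *\<^sub>R b) \<bullet> grad x)) (at (0::real))"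
      by (rule has_derivative_compose[of "\<lambda>h. x + h *\<^sub>R b", where g = f])
         (auto intro!: derivative_eq_intros fd)
    moreover have "(\<lambda>h::real. (h *\<^sub>R b) \<bullet> grad x) = (*) (grad x \<bullet> b)"
      by (auto simp: inner_commute)
    ultimately have "((\<lambda>h. f (x + h *\<^sub>R b)) has_field_derivative grad x \<bullet> b) (at (0::real))"
      by (simp add: has_field_derivative_def)
    then have "((\<lambda>h. (f (x + h *\<^sub>R b) - f x) / h) \<longlongrightarrow> grad x \<bullet> b) (at 0)"
      by (simp add: DERIV_def)
    moreover have "filterlim (\<lambda>n. 1 / real (Suc n)) (at (0::real)) sequentially"
      using LIMSEQ_Suc[OF lim_1_over_n] by (auto simp: filterlim_at)
    ultimately have "(\<lambda>n. (f (x + (1 / real (Suc n)) *\<^sub>R b) - f x) / (1 / real (Suc n)))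
        \<longlonglongrightarrow> grad x \<bullet> b"
      by (rule filterlim_compose)
    then show ?thesis by (simp add: mult.commute)
  qed
  show "(\<lambda>x. grad x \<bullet> b) \<in> borel_measurable borel"
    by (rule borel_measurable_LIMSEQ_real[OF lim]) measurable
qed

end

section \<open>Bias and variance of clipping\<close>

lemma norm_clip_le: "0 \<le> \<Lambda> \<Longrightarrow> norm (clip \<Lambda> v) \<le> \<Lambda>"
  by (auto simp: clip_def min_def field_simps)

lemma clip_eq_self: "norm v \<le> \<Lambda> \<Longrightarrow> clip \<Lambda> v = v"
  by (auto simp: clip_def min_def field_simps)

lemma norm_diff_clip:
  assumes "0 \<le> \<Lambda>"
  shows "norm (v - clip \<Lambda> v) = max 0 (norm v - \<Lambda>)"
proof (cases "norm v \<le> \<Lambda>")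
  case True
  then show ?thesis by (simp add: clip_eq_self)
next
  case False
  then have "v \<noteq> 0" using assms by auto
  then have "v - clip \<Lambda> v = (1 - \<Lambda> / norm v) *\<^sub>R v"
    using False by (simp add: clip_def min_def scaleR_diff_left)
  then have "norm (v - clip \<Lambda> v) = \<bar>1 - \<Lambda> / norm v\<bar> * norm v"
    by (simp only: norm_scaleR)
  also have "\<bar>1 - \<Lambda> / norm v\<bar> = 1 - \<Lambda> / norm v"
    using False \<open>v \<noteq> 0\<close> by (intro abs_of_nonneg) simp
  also have "(1 - \<Lambda> / norm v) * norm v = norm v - \<Lambda>"
    using \<open>v \<noteq> 0\<close> by (simp add: left_diff_distrib)
  finally show ?thesis using False by simp
qed

text \<open>
  As a metric projection onto a convex set, clipping inherits 1-Lipschitz continuity. Optimality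
  of the clipped vector is the reverse triangle inequality.
\<close>
lemma clip_eq_closest_point:
  fixes v :: "'a::euclidean_space"
  assumes "0 \<le> \<Lambda>"
  shows "clip \<Lambda> v = closest_point (cball 0 \<Lambda>) v"
proof (rule closest_point_unique)
  show "clip \<Lambda> v \<in> cball 0 \<Lambda>"
    using norm_clip_le[OF assms] by simp
  show "\<forall>z\<in>cball 0 \<Lambda>. dist v (clip \<Lambda> v) \<le> dist v z"
  proof
    fix z :: 'a assume "z \<in> cball 0 \<Lambda>"
    then show "dist v (clip \<Lambda> v) \<le> dist v z"
      using norm_triangle_ineq2[of v z] by (simp add: dist_norm norm_diff_clip[OF assms])
  qed
qed auto

text \<open>
  Clipping is 1-Lipschitz and fixes the ball, so it brings no sample further from a true gradient
  inside the ball.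
\<close>
lemma clip_nonexpansive_to_ball:
  fixes v m :: "'a::euclidean_space"
  assumes "norm m \<le> \<Lambda>"
  shows "norm (clip \<Lambda> v - m) \<le> norm (v - m)"
proof -
  have \<Lambda>: "0 \<le> \<Lambda>" using assms norm_ge_zero[of m] by linarith
  have "clip \<Lambda> m = m" using assms by (rule clip_eq_self)
  moreover have "dist (clip \<Lambda> v) (clip \<Lambda> m) \<le> dist v m"
    unfolding clip_eq_closest_point[OF \<Lambda>]
    by (rule closest_point_lipschitz) (use \<Lambda> in auto)
  ultimately show ?thesis by (simp add: dist_norm)
qed

lemma borel_measurable_clip [measurable]:
  "(clip \<Lambda> :: 'a::euclidean_space \<Rightarrow> 'a) \<in> borel_measurable borel"
  unfolding clip_def[abs_def] by measurable

text \<open>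
  Clipping is active only when the noise \<open>N = norm (v - m)\<close> exceeds \<open>\<Lambda> / 2\<close>. The clipped-off
  part is at most \<open>N\<close>, and \<open>N\<close> times the extra factor \<open>(2 * N / \<Lambda>) powr (p - 1) \<ge> 1\<close> is a
  multiple of the \<open>p\<close>-th power. This pointwise form turns into a bias bound under any
  conditional expectation.
\<close>
lemma norm_diff_clip_le_powr:
  assumes "norm m \<le> \<Lambda> / 2" and "0 < \<Lambda>" and "1 < p"
  shows "norm (v - clip \<Lambda> v) \<le> (2 / \<Lambda>) powr (p - 1) * norm (v - m) powr p"
proof (cases "norm v \<le> \<Lambda>")
  case True
  then show ?thesis using assms norm_diff_clip[of \<Lambda> v] by simp
next
  case False
  define N where "N = norm (v - m)"
  have "norm v - \<Lambda> / 2 \<le> N"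
    using assms norm_triangle_ineq2[of v m] by (simp add: N_def)
  then have N: "norm v - \<Lambda> \<le> N" "1 \<le> 2 / \<Lambda> * N" "0 < N" using False assms by (auto simp: field_simps)
  have "norm (v - clip \<Lambda> v) \<le> N"
    using False N assms by (simp add: norm_diff_clip)
  also have "\<dots> \<le> N * (2 / \<Lambda> * N) powr (p - 1)"
    using N assms ge_one_powr_ge_zero[of "2 / \<Lambda> * N" "p - 1"] by simp
  also have "\<dots> = (2 / \<Lambda>) powr (p - 1) * (N powr 1 * N powr (p - 1))"
    using N by (subst powr_mult) (simp add: mult.left_commute)
  also have "N powr 1 * N powr (p - 1) = N powr p"
    by (subst powr_add[symmetric]) simp
  finally show ?thesis by (simp add: N_def)
qed

text \<open>
  The square is split as \<open>n powr (2 - p) * n powr p\<close>: the first part is controlled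
  by the boundedness of the clipped vector, the second by the noise. Only the \<open>p\<close>-th moment is
  then needed to control a second moment.
\<close>
lemma norm_clip_diff_sq_le_powr:
  fixes v m :: "'a::euclidean_space"
  assumes "norm m \<le> \<Lambda> / 2" and "0 < \<Lambda>" and "0 \<le> p" and "p \<le> 2"
  shows "(norm (clip \<Lambda> v - m))\<^sup>2 \<le> (3 / 2 * \<Lambda>) powr (2 - p) * norm (v - m) powr p"
proof (cases "clip \<Lambda> v = m")
  case True
  then show ?thesis by simp
next
  case False
  define n where "n = norm (clip \<Lambda> v - m)"
  have n: "0 < n" using False by (simp add: n_def)
  have "n \<le> norm (clip \<Lambda> v) + norm m" unfolding n_def by (rule norm_triangle_ineq4)
  also have "\<dots> \<le> 3 / 2 * \<Lambda>" using norm_clip_le[of \<Lambda> v] assms by simp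
  finally have nL: "n \<le> 3 / 2 * \<Lambda>" .
  have nN: "n \<le> norm (v - m)"
    unfolding n_def by (rule clip_nonexpansive_to_ball) (use assms in auto)
  have "n\<^sup>2 = n powr (2 - p) * n powr p"
    using n by (simp add: powr_add[symmetric])
  also have "\<dots> \<le> (3 / 2 * \<Lambda>) powr (2 - p) * norm (v - m) powr p"
    using n nL nN assms by (intro mult_mono powr_mono2) auto
  finally show ?thesis by (simp add: n_def)
qed

section \<open>Arithmetic of the phase parameters\<close>

locale phase_parameters = smooth_convex_objective f grad \<mu> H0 H1 xstar
  for f :: "'a::euclidean_space \<Rightarrow> real" and grad \<mu> H0 H1 xstar +
  fixes Q :: "'a set" and w :: 'a and p \<sigma>0 \<sigma>1 \<sigma>2 \<rho> \<Delta> D \<Lambda> a :: real and T :: nat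
  assumes p: "1 < p" "p \<le> 2"
    and \<rho>: "0 < \<rho>" "\<rho> < 1" and \<Delta>_pos: "0 < \<Delta>"
    and Q: "closed Q" "convex Q" "bounded Q" and w_in_Q: "w \<in> Q" and xstar_in_Q: "xstar \<in> Q"
    and D: "D = diameter Q" and D_pos: "0 < D"
    and gap_w: "opt_gap f w \<le> \<Delta>"
    and \<Lambda>: "\<Lambda> = clip_level H0 H1 p \<sigma>0 \<sigma>1 \<sigma>2 \<Delta> D"
    and T: "T = phase_length \<Lambda> \<Delta> D \<rho>"
    and a: "a = phase_step \<Delta> D T"
begin

abbreviation "G \<equiv> grad_bound H0 H1 \<Delta>"
abbreviation "noise \<equiv> noise_pow H0 H1 p \<sigma>0 \<sigma>1 \<sigma>2 \<Delta>"
abbreviation "h \<equiv> local_smoothness H0 H1 \<Delta>"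
abbreviation "A \<equiv> phase_weight \<Delta> D a"
abbreviation "l \<equiv> ln (8 / \<rho>)"

text \<open>
  The dual parameter of the Chernoff bound: each \<open>D^2\<close> of excess of the potential then
  costs a factor \<open>\<rho> / 8\<close> in probability.
\<close>
definition exponent :: real where "exponent = l / D\<^sup>2"

lemma l_ge_1: "1 \<le> l"
proof -
  have "exp 1 \<le> (3::real)" by (rule exp_le)
  also have "\<dots> \<le> 8 / \<rho>" using \<rho> by (simp add: field_simps)
  finally show ?thesis using \<rho> by (simp add: ln_ge_iff)
qed

lemma h_nonneg: "0 \<le> h"
  using H0_nonneg H1_nonneg \<Delta>_pos by (simp add: local_smoothness_def)

lemma G_nonneg: "0 \<le> G"
  using h_nonneg C_star_pos \<Delta>_pos by (simp add: grad_bound_def)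

lemma noise_nonneg: "0 \<le> noise"
  by (simp add: noise_pow_def)

lemma G_le: "2 * G \<le> \<Lambda>"
  by (simp add: \<Lambda> clip_level_def)

lemma \<Lambda>_nonneg: "0 \<le> \<Lambda>"
  using G_le G_nonneg by simp

text \<open>
  Written in this form the choice of the clipping level bounds the bias of a clipped sample by a
  small multiple of \<open>\<Delta> / D\<close>.
\<close>
lemma noise_le: "64 * noise * D / \<Delta> \<le> \<Lambda> powr (p - 1)"
proof -
  have nn: "0 \<le> 64 * noise * D / \<Delta>" using noise_nonneg D_pos \<Delta>_pos by simp
  have "64 * noise * D / \<Delta> = ((64 * noise * D / \<Delta>) powr (1 / (p - 1))) powr (p - 1)"
    using p powr_one[OF nn] by (simp only: powr_powr) simp
  also have "\<dots> \<le> \<Lambda> powr (p - 1)"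
    using p by (intro powr_mono2) (auto simp: \<Lambda> clip_level_def)
  finally show ?thesis .
qed

lemma T_ge: "1024 * (1 + D * \<Lambda> / \<Delta>) * l \<le> real T"
  unfolding T phase_length_def Let_def by (rule real_nat_ceiling_ge)

lemma T_ge_1024: "1024 \<le> real T"
proof -
  have "1024 * 1 * 1 \<le> 1024 * (1 + D * \<Lambda> / \<Delta>) * l"
    using l_ge_1 \<Lambda>_nonneg D_pos \<Delta>_pos by (intro mult_mono) auto
  then show ?thesis using T_ge by linarith
qed

lemma D_\<Lambda>_le: "1024 * l * (D * \<Lambda>) \<le> \<Delta> * real T"
proof -
  have "1024 * (D * \<Lambda> / \<Delta>) * l \<le> 1024 * (1 + D * \<Lambda> / \<Delta>) * l"
    using l_ge_1 by (intro mult_right_mono) auto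
  also have "\<dots> \<le> T" by (rule T_ge)
  finally have "\<Delta> * (1024 * (D * \<Lambda> / \<Delta>) * l) \<le> \<Delta> * T"
    using \<Delta>_pos by (intro mult_left_mono) auto
  then show ?thesis using \<Delta>_pos by (simp add: mult_ac)
qed

lemma a_pos: "0 < a"
  using T_ge_1024 D_pos \<Delta>_pos by (simp add: a phase_step_def)

lemma a_eq: "a * (\<Delta> * real T) = 5 * D\<^sup>2"
  using T_ge_1024 \<Delta>_pos by (simp add: a phase_step_def)

text \<open>
  The step is so short that one clipped gradient moves the iterate by at most a fraction \<open>1 / l\<close>
  of \<open>D\<close>; this keeps the Chernoff exponent of a single increment below one.
\<close>
lemma a_\<Lambda>_le: "1024 * l * (a * \<Lambda>) \<le> 5 * D"
proof -
  have "D * (1024 * l * (a * \<Lambda>)) = a * (1024 * l * (D * \<Lambda>))" by simp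
  also have "\<dots> \<le> a * (\<Delta> * T)" using D_\<Lambda>_le a_pos by (intro mult_left_mono) auto
  also have "\<dots> = D * (5 * D)" by (simp add: a_eq power2_eq_square)
  finally show ?thesis using D_pos by simp
qed

text \<open>
  The clipping level dominates the gradient bound, so smallness of \<open>\<Lambda>\<close> times a displacement
  controls both the first and the second order terms of the smoothness inequality.
\<close>
lemma \<Lambda>_sq_ge: "128 * C_star H1 * \<Delta> * h \<le> \<Lambda>\<^sup>2"
proof -
  have "(2 * G)\<^sup>2 \<le> \<Lambda>\<^sup>2" using G_le G_nonneg by (intro power_mono) auto
  moreover have "G\<^sup>2 = 32 * C_star H1 * \<Delta> * h"
    using h_nonneg C_star_pos \<Delta>_pos by (simp add: grad_bound_def)
  ultimately show ?thesis by (simp add: power_mult_distrib)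
qed

lemma A_Suc: "A (Suc t) = A t + a"
  by (simp add: phase_weight_def algebra_simps)

lemma A_ge: "D\<^sup>2 / \<Delta> \<le> A t"
  using a_pos by (simp add: phase_weight_def)

lemma A_pos: "0 < A t"
proof -
  have "0 < D\<^sup>2 / \<Delta>" using D_pos \<Delta>_pos by simp
  then show ?thesis using A_ge[of t] by linarith
qed

lemma A_T: "A T = 6 * D\<^sup>2 / \<Delta>"
  using a_eq \<Delta>_pos by (simp add: phase_weight_def field_simps)

lemma step_ratio_le: "a / A t \<le> 5 / real T"
proof -
  have "a * T = 5 * (D\<^sup>2 / \<Delta>)" using a_eq \<Delta>_pos by (simp add: field_simps)
  also have "\<dots> \<le> 5 * A t" using A_ge by (intro mult_left_mono) auto
  finally show ?thesis using A_pos[of t] T_ge_1024 by (simp add: field_simps)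
qed

context
  fixes n :: real
  assumes n: "0 \<le> n" "n \<le> 5 * D / real T"
begin

text \<open>
  Since \<open>a / A t \<le> 5 / T\<close>, displacements of length \<open>n \<le> 5 * D / T\<close> are those caused by one
  averaging step. Because \<open>T\<close> dominates \<open>1024 * D * \<Lambda> / \<Delta>\<close>, such a displacement times \<open>\<Lambda>\<close> is a
  small fraction of \<open>\<Delta>\<close>; here and below the constants are rounded generously.
\<close>
lemma \<Lambda>_short_move: "\<Lambda> * n \<le> \<Delta> / 200"
proof -
  have "1024 * 1 * (D * \<Lambda>) \<le> 1024 * l * (D * \<Lambda>)"
    using l_ge_1 D_pos \<Lambda>_nonneg by (intro mult_right_mono) auto
  then have "1024 * (D * \<Lambda>) \<le> \<Delta> * T" using D_\<Lambda>_le by simp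
  moreover have "0 \<le> D * \<Lambda>" using D_pos \<Lambda>_nonneg by simp
  ultimately have "1000 * (D * \<Lambda>) \<le> \<Delta> * T" by linarith
  then have "\<Lambda> * (5 * D / T) \<le> \<Delta> / 200"
    using T_ge_1024 \<Delta>_pos by (simp add: field_simps)
  moreover have "\<Lambda> * n \<le> \<Lambda> * (5 * D / T)"
    using n \<Lambda>_nonneg by (intro mult_left_mono) auto
  ultimately show ?thesis by linarith
qed

lemma \<Lambda>_short_move_sq: "128 * C_star H1 * \<Delta> * h * n\<^sup>2 \<le> \<Delta>\<^sup>2 / 40000"
proof -
  have "128 * C_star H1 * \<Delta> * h * n\<^sup>2 \<le> \<Lambda>\<^sup>2 * n\<^sup>2"
    by (intro mult_right_mono \<Lambda>_sq_ge) auto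
  also have "\<dots> = (\<Lambda> * n)\<^sup>2" by (simp add: power_mult_distrib)
  also have "\<dots> \<le> (\<Delta> / 200)\<^sup>2"
    using \<Lambda>_short_move \<Lambda>_nonneg n by (intro power_mono) auto
  finally show ?thesis by (simp add: power_divide)
qed

text \<open>
  This makes smoothness applicable both from \<open>y\<close> to the query and from the query to the next
  \<open>y\<close>: multiplied by \<open>\<Delta>^2\<close>, the requirement on the radius follows from the bound on
  \<open>\<Lambda> * n\<close>, since \<open>H1 * \<Delta> \<le> h\<close>.
\<close>
lemma short_move_in_radius: "ereal n \<le> smoothness_radius H1"
proof (rule smoothness_radius_ge)
  have "\<Delta>\<^sup>2 * (C_star H1 * H1 * n\<^sup>2) = (C_star H1 * \<Delta> * n\<^sup>2) * (H1 * \<Delta>)"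
    by (simp add: power2_eq_square)
  also have "\<dots> \<le> (C_star H1 * \<Delta> * n\<^sup>2) * h"
    using H0_nonneg C_star_pos \<Delta>_pos by (intro mult_left_mono) (auto simp: local_smoothness_def)
  also have "\<dots> \<le> 128 * C_star H1 * \<Delta> * h * n\<^sup>2"
    using h_nonneg C_star_pos \<Delta>_pos by simp
  also have "\<dots> \<le> \<Delta>\<^sup>2 / 40000" by (rule \<Lambda>_short_move_sq)
  also have "\<dots> \<le> \<Delta>\<^sup>2 * 1" by simp
  finally show "C_star H1 * H1 * n\<^sup>2 \<le> 1"
    using \<Delta>_pos by (subst (asm) mult_le_cancel_left_pos) auto
qed (use n in simp)

lemma h_short_move_sq: "h * n\<^sup>2 \<le> \<Delta> / 1000"
proof -
  have "1 * (\<Delta> * (h * n\<^sup>2)) \<le> (128 * C_star H1) * (\<Delta> * (h * n\<^sup>2))"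
    using two_le_C_star h_nonneg \<Delta>_pos by (intro mult_right_mono) auto
  then have "\<Delta> * (h * n\<^sup>2) \<le> (128 * C_star H1) * (\<Delta> * (h * n\<^sup>2))"
    by (simp only: mult_1)
  also have "\<dots> \<le> \<Delta>\<^sup>2 / 40000" using \<Lambda>_short_move_sq by (simp add: mult_ac)
  also have "\<dots> \<le> \<Delta> * (\<Delta> / 1000)" by (simp add: power2_eq_square)
  finally show ?thesis using \<Delta>_pos by (subst (asm) mult_le_cancel_left_pos) auto
qed

end

lemma smoothness_constant_le:
  assumes "opt_gap f x \<le> 4 * \<Delta>"
  shows "H0 + H1 * opt_gap f x \<le> 4 * h"
proof -
  have "H1 * opt_gap f x \<le> H1 * (4 * \<Delta>)"
    using assms H1_nonneg by (intro mult_left_mono) auto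
  then show ?thesis using H0_nonneg by (simp add: local_smoothness_def algebra_simps)
qed

lemma opt_gap_short_move:
  assumes y: "opt_gap f y \<le> 3 * \<Delta>" and n: "norm (u - y) \<le> 5 * D / real T"
  shows "opt_gap f u \<le> 4 * \<Delta>"
proof -
  let ?n = "norm (u - y)"
  have y4: "opt_gap f y \<le> 4 * \<Delta>" using y \<Delta>_pos by simp
  have "grad y \<bullet> (u - y) \<le> norm (grad y) * ?n" by (rule norm_cauchy_schwarz)
  also have "\<dots> \<le> \<Lambda> * ?n"
    using norm_grad_le_grad_bound[OF y4 \<Delta>_pos] G_le G_nonneg by (intro mult_right_mono) auto
  also have "\<dots> \<le> \<Delta> / 200" using n by (intro \<Lambda>_short_move) auto
  finally have lin: "grad y \<bullet> (u - y) \<le> \<Delta> / 200" .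
  have "(H0 + H1 * opt_gap f y) * ?n\<^sup>2 \<le> (4 * h) * ?n\<^sup>2"
    by (intro mult_right_mono smoothness_constant_le y4) auto
  also have "\<dots> \<le> 4 * (\<Delta> / 1000)" using h_short_move_sq[of ?n] n by simp
  finally have quad: "(H0 + H1 * opt_gap f y) * ?n\<^sup>2 \<le> 4 * (\<Delta> / 1000)" .
  have "opt_gap f u \<le> opt_gap f y + grad y \<bullet> (u - y) + (H0 + H1 * opt_gap f y) * ?n\<^sup>2"
    using n by (intro opt_gap_smooth_upper short_move_in_radius) auto
  then show ?thesis using y lin quad \<Delta>_pos by linarith
qed

lemma norm_diff_le_D: "x \<in> Q \<Longrightarrow> y \<in> Q \<Longrightarrow> norm (x - y) \<le> D"
  using diameter_bounded_bound[OF Q(3)] by (simp add: D dist_norm)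

lemma average_in_Q:
  assumes "y \<in> Q" "z \<in> Q"
  shows "(A t *\<^sub>R y + a *\<^sub>R z) /\<^sub>R A (Suc t) \<in> Q"
proof -
  have "(A t / A (Suc t)) *\<^sub>R y + (a / A (Suc t)) *\<^sub>R z \<in> Q"
    using Q assms A_pos[of t] A_pos[of "Suc t"] a_pos
    by (intro convexD) (auto simp: A_Suc add_divide_distrib[symmetric])
  then show ?thesis by (simp add: scaleR_add_right divide_inverse_commute)
qed

section \<open>Decrease of the accelerated potential along one step\<close>

text \<open>
  The Lyapunov function of accelerated gradient descent. It starts below \<open>3/2 * D^2\<close>, and
  staying below \<open>3 * D^2\<close> until time \<open>T\<close> is enough because the final weight is
  \<open>6 * D^2 / \<Delta>\<close>.
\<close>
definition potential :: "nat \<Rightarrow> 'a \<times> 'a \<Rightarrow> real" where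
  "potential t yz = A t * opt_gap f (fst yz) + (norm (snd yz - xstar))\<^sup>2 / 2"

lemma potential_nonneg: "0 \<le> potential t yz"
  using A_pos[of t] opt_gap_nonneg by (simp add: potential_def)

lemma potential_initial: "potential 0 (w, w) \<le> 3 / 2 * D\<^sup>2"
proof -
  have "D\<^sup>2 / \<Delta> * opt_gap f w \<le> D\<^sup>2 / \<Delta> * \<Delta>"
    using gap_w \<Delta>_pos by (intro mult_left_mono) auto
  then have "D\<^sup>2 / \<Delta> * opt_gap f w \<le> D\<^sup>2" using \<Delta>_pos by simp
  moreover have "(norm (w - xstar))\<^sup>2 \<le> D\<^sup>2"
    using norm_diff_le_D[OF w_in_Q xstar_in_Q] by (intro power_mono) auto
  moreover have "potential 0 (w, w) = D\<^sup>2 / \<Delta> * opt_gap f w + (norm (w - xstar))\<^sup>2 / 2"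
    by (simp add: potential_def phase_weight_def)
  ultimately show ?thesis by linarith
qed

lemma opt_gap_le_of_potential:
  assumes "potential t (y, z) \<le> 3 * D\<^sup>2"
  shows "opt_gap f y \<le> 3 * D\<^sup>2 / A t"
proof -
  have "A t * opt_gap f y \<le> potential t (y, z)" by (simp add: potential_def)
  then have "A t * opt_gap f y \<le> 3 * D\<^sup>2" using assms by linarith
  then show ?thesis using A_pos[of t] by (simp add: field_simps)
qed

lemma opt_gap_final:
  assumes "potential T (y, z) \<le> 3 * D\<^sup>2"
  shows "opt_gap f y \<le> \<Delta> / 2"
  using opt_gap_le_of_potential[OF assms] D_pos \<Delta>_pos by (simp add: A_T)

context
  fixes t :: nat and y z v u y' z' :: 'a
  assumes yz: "y \<in> Q" "z \<in> Q" and pot: "potential t (y, z) \<le> 3 * D\<^sup>2"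
  defines "u \<equiv> (A t *\<^sub>R y + a *\<^sub>R z) /\<^sub>R A (Suc t)"
    and "z' \<equiv> closest_point Q (z - a *\<^sub>R v)"
    and "y' \<equiv> (A t *\<^sub>R y + a *\<^sub>R z') /\<^sub>R A (Suc t)"
begin

lemma z'_in_Q: "z' \<in> Q"
  unfolding z'_def using Q yz by (intro closest_point_in_set) auto

lemma short_move:
  assumes "x \<in> Q" "x' \<in> Q"
  shows "norm ((a / A (Suc t)) *\<^sub>R (x - x')) \<le> 5 * D / real T"
proof -
  have "norm ((a / A (Suc t)) *\<^sub>R (x - x')) = a / A (Suc t) * norm (x - x')"
    using a_pos A_pos[of "Suc t"] by simp
  also have "\<dots> \<le> 5 / T * D"
    using a_pos A_pos[of "Suc t"] step_ratio_le norm_diff_le_D assms by (intro mult_mono) auto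
  finally show ?thesis by simp
qed

lemma A_u: "A (Suc t) *\<^sub>R u = A t *\<^sub>R y + a *\<^sub>R z"
  using A_pos[of "Suc t"] by (simp add: u_def)

text \<open>
  The query differs from \<open>y\<close> by a short move, so the bound \<open>3 * \<Delta>\<close> that the potential gives at
  \<open>y\<close> degrades to at most \<open>4 * \<Delta>\<close>.
\<close>
lemma query_gap: "opt_gap f u \<le> 4 * \<Delta>"
proof (rule opt_gap_short_move)
  have "3 * D\<^sup>2 / A t \<le> 3 * \<Delta>"
    using A_ge[of t] A_pos[of t] \<Delta>_pos by (simp add: field_simps)
  then show "opt_gap f y \<le> 3 * \<Delta>" using opt_gap_le_of_potential[OF pot] by simp
  have "A (Suc t) *\<^sub>R (u - y) = a *\<^sub>R (z - y)"
    by (simp add: scaleR_diff_right A_u) (simp add: A_Suc scaleR_add_left)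
  then have "(1 / A (Suc t)) *\<^sub>R (A (Suc t) *\<^sub>R (u - y)) = (1 / A (Suc t)) *\<^sub>R (a *\<^sub>R (z - y))"
    by simp
  then have "u - y = (a / A (Suc t)) *\<^sub>R (z - y)"
    using A_pos[of "Suc t"] by simp
  then show "norm (u - y) \<le> 5 * D / real T"
    using short_move yz by simp
qed

lemma y'_minus_u: "y' - u = (a / A (Suc t)) *\<^sub>R (z' - z)"
  by (simp add: y'_def u_def scaleR_diff_right[symmetric] divide_inverse_commute)

text \<open>
  The quadratic term of the smoothness inequality is absorbed by part of the
  \<open>(norm (z' - z))^2 / 2\<close> that the projection step gains.
\<close>
lemma curvature_le: "A (Suc t) * ((H0 + H1 * opt_gap f u) * (norm (y' - u))\<^sup>2) \<le> (norm (z' - z))\<^sup>2 / 4"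
proof -
  let ?L = "H0 + H1 * opt_gap f u" and ?A = "A (Suc t)"
  have L: "?L \<le> 4 * h" by (intro smoothness_constant_le query_gap)
  have rn: "0 \<le> 5 * D / real T" using D_pos by simp
  have ratio: "a / ?A \<le> 5 / T" by (rule step_ratio_le)
  have pos: "0 < ?A" by (rule A_pos)
  have "?A * (?L * (norm (y' - u))\<^sup>2) = ((a / ?A) * a * ?L) * (norm (z' - z))\<^sup>2"
    using pos a_pos by (simp add: y'_minus_u power_mult_distrib power2_eq_square)
  also have "\<dots> \<le> ((5 / T) * a * (4 * h)) * (norm (z' - z))\<^sup>2"
    using ratio L a_pos pos H0_nonneg H1_nonneg opt_gap_nonneg
    by (intro mult_right_mono mult_mono) auto
  also have "(5 / T) * a * (4 * h) = 4 / \<Delta> * (h * (5 * D / T)\<^sup>2)"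
    by (simp add: a phase_step_def power2_eq_square mult_ac)
  also have "\<dots> \<le> 4 / \<Delta> * (\<Delta> / 1000)"
    using \<Delta>_pos by (intro mult_left_mono h_short_move_sq) (use D_pos in auto)
  also have "\<dots> \<le> 1 / 4" using \<Delta>_pos by simp
  finally show ?thesis by (simp add: mult_right_mono)
qed

text \<open>
  Convexity at the query, used towards \<open>y\<close> and towards the minimizer, and smoothness from the query
  to \<open>y'\<close> leave the linear term \<open>a * (grad u \<bullet> (z' - xstar))\<close>; the variational inequality of the
  projection contributes the same term with \<open>v\<close> and the opposite sign. The difference is split at
  \<open>z\<close>, so that one part has a direction determined before the current sample is drawn, and the other part is
  absorbed by Young's inequality.
\<close>
lemma potential_step:
  "potential (Suc t) (y', z')
     \<le> potential t (y, z) + (a * ((grad u - v) \<bullet> (z - xstar)) + a\<^sup>2 * (norm (v - grad u))\<^sup>2)"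
proof -
  let ?F = "opt_gap f" and ?A = "A (Suc t)" and ?d = "norm (z' - z)"
  have "A t * (?F u + grad u \<bullet> (y - u)) \<le> A t * ?F y"
    using A_pos[of t] by (intro mult_left_mono opt_gap_convex_lower) auto
  moreover have "a * (?F u + grad u \<bullet> (xstar - u)) \<le> a * ?F xstar"
    using a_pos by (intro mult_left_mono opt_gap_convex_lower) auto
  ultimately have "?A * ?F u + grad u \<bullet> (A t *\<^sub>R y + a *\<^sub>R xstar - ?A *\<^sub>R u) \<le> A t * ?F y"
    by (simp add: A_Suc opt_gap_xstar algebra_simps inner_diff_right inner_add_right)
  then have conv: "?A * ?F u \<le> A t * ?F y + a * (grad u \<bullet> (z - xstar))"
    by (simp add: A_u algebra_simps inner_diff_right inner_add_right)
  have "norm (y' - u) \<le> 5 * D / real T"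
    using short_move[OF z'_in_Q yz(2)] by (simp add: y'_minus_u)
  then have "?F y' \<le> ?F u + grad u \<bullet> (y' - u) + (H0 + H1 * ?F u) * (norm (y' - u))\<^sup>2"
    by (intro opt_gap_smooth_upper short_move_in_radius) auto
  then have "?A * ?F y' \<le> ?A * (?F u + grad u \<bullet> (y' - u) + (H0 + H1 * ?F u) * (norm (y' - u))\<^sup>2)"
    using A_pos[of "Suc t"] by (intro mult_left_mono) auto
  moreover have "?A * (grad u \<bullet> (y' - u)) = a * (grad u \<bullet> (z' - z))"
    using A_pos[of "Suc t"] by (simp add: y'_minus_u)
  ultimately have smooth: "?A * ?F y' \<le> ?A * ?F u + a * (grad u \<bullet> (z' - z)) + ?d\<^sup>2 / 4"
    using curvature_le by (simp add: distrib_left)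
  \<comment> \<open>Optimality of the projection, tested with the minimizer.\<close>
  have "((z - a *\<^sub>R v) - z') \<bullet> (xstar - z') \<le> 0"
    unfolding z'_def by (rule closest_point_dot) (use Q xstar_in_Q in auto)
  then have proj: "a * (v \<bullet> (z' - xstar)) \<le> (norm (z - xstar))\<^sup>2 / 2 - (norm (z' - xstar))\<^sup>2 / 2 - ?d\<^sup>2 / 2"
    by (simp add: power2_norm_eq_inner inner_diff_left inner_diff_right inner_commute
        algebra_simps diff_divide_distrib add_divide_distrib)
  have "a * ((grad u - v) \<bullet> (z' - z)) \<le> a * (norm (grad u - v) * ?d)"
    using a_pos by (intro mult_left_mono norm_cauchy_schwarz) auto
  also have "\<dots> \<le> (a * norm (grad u - v))\<^sup>2 + ?d\<^sup>2 / 4"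
    using zero_le_power2[of "a * norm (grad u - v) - ?d / 2"]
    by (simp add: power2_eq_square algebra_simps)
  finally have young: "a * ((grad u - v) \<bullet> (z' - z)) \<le> a\<^sup>2 * (norm (v - grad u))\<^sup>2 + ?d\<^sup>2 / 4"
    by (simp add: power_mult_distrib norm_minus_commute)
  have "a * (grad u \<bullet> (z - xstar)) + a * (grad u \<bullet> (z' - z)) - a * (v \<bullet> (z' - xstar))
      = a * ((grad u - v) \<bullet> (z - xstar)) + a * ((grad u - v) \<bullet> (z' - z))"
    by (simp add: inner_diff_left inner_diff_right algebra_simps)
  then show ?thesis
    using conv smooth proj young by (simp add: potential_def)
qed

end

section \<open>Exponential bound for one increment\<close>

text \<open>
  For negative \<open>x\<close> this follows from \<open>exp (- x) \<ge> 1 - x\<close> because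
  \<open>(1 + x + x^2) * (1 - x) = 1 - x^3 \<ge> 1\<close>.
\<close>
lemma (in -) exp_le_quadratic:
  fixes x :: real
  assumes "x \<le> 1"
  shows "exp x \<le> 1 + x + x\<^sup>2"
proof (cases "0 \<le> x")
  case True
  then show ?thesis using assms by (rule exp_bound)
next
  case False
  have "exp (- x) \<ge> 1 - x" using exp_ge_add_one_self[of "- x"] by simp
  then have "exp x \<le> 1 / (1 - x)"
    using False by (simp add: exp_minus field_simps)
  also have "\<dots> \<le> 1 + x + x\<^sup>2"
  proof -
    have "(1 + x + x\<^sup>2) * (1 - x) = 1 - x ^ 3" by (simp add: power2_eq_square power3_eq_cube algebra_simps)
    also have "\<dots> \<ge> 1" using False by (simp add: power3_eq_cube mult_nonneg_nonpos2 zero_le_mult_iff mult_le_0_iff)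
    finally show ?thesis using False by (simp add: field_simps)
  qed
  finally show ?thesis .
qed

lemma exponent_pos: "0 < exponent"
  using l_ge_1 D_pos by (simp add: exponent_def)

lemma exponent_a: "exponent * (a * \<Delta>) = 5 * l / real T"
  using D_pos \<Delta>_pos T_ge_1024 by (simp add: exponent_def a phase_step_def)

definition increment :: "'a \<Rightarrow> 'a \<Rightarrow> 'a \<Rightarrow> real" where
  "increment m v d = a * ((m - clip \<Lambda> v) \<bullet> d) + a\<^sup>2 * (norm (clip \<Lambda> v - m))\<^sup>2"

text \<open>
  The first term accounts for the clipping bias, the second for the quadratic part of the increment
  and for its second moment in the expansion of the exponential. All three are multiples of the same
  \<open>p\<close>-th power of the noise.
\<close>
definition moment_coeff :: real where
  "moment_coeff = exponent * a * D * (2 / \<Lambda>) powr (p - 1)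
     + (exponent * a\<^sup>2 + 4 * (exponent * a * D)\<^sup>2) * (3 / 2 * \<Lambda>) powr (2 - p)"

context
  fixes m v d :: 'a
  assumes m: "norm m \<le> G" and d: "norm d \<le> D"
begin

lemma clip_error_le: "a * norm (clip \<Lambda> v - m) \<le> 8 / (1024 * l) * D"
proof -
  have "norm (clip \<Lambda> v - m) \<le> norm (clip \<Lambda> v) + norm m" by (rule norm_triangle_ineq4)
  also have "\<dots> \<le> 3 / 2 * \<Lambda>" using norm_clip_le[OF \<Lambda>_nonneg, of v] m G_le by simp
  finally have "a * norm (clip \<Lambda> v - m) \<le> 3 / 2 * (a * \<Lambda>)"
    using a_pos by simp
  also have "\<dots> \<le> 8 / (1024 * l) * D"
    using a_\<Lambda>_le l_ge_1 D_pos by (simp add: field_simps)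
  finally show ?thesis .
qed

lemma abs_increment_le: "\<bar>increment m v d\<bar> \<le> 2 * a * D * norm (clip \<Lambda> v - m)"
proof -
  let ?e = "norm (clip \<Lambda> v - m)"
  have "a * ?e \<le> 8 / (1024 * l) * D" by (rule clip_error_le)
  also have "\<dots> \<le> 1 * D" using l_ge_1 D_pos by (intro mult_right_mono) (auto simp: field_simps)
  finally have "(a * ?e) * (a * ?e) \<le> (a * ?e) * D" using a_pos by (intro mult_left_mono) auto
  then have quad: "a\<^sup>2 * ?e\<^sup>2 \<le> a * D * ?e" by (simp add: power2_eq_square mult_ac)
  have "\<bar>(m - clip \<Lambda> v) \<bullet> d\<bar> \<le> ?e * norm d"
    using Cauchy_Schwarz_ineq2[of "m - clip \<Lambda> v" d] by (simp add: norm_minus_commute)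
  also have "\<dots> \<le> ?e * D" using d by (intro mult_left_mono) auto
  finally have "\<bar>a * ((m - clip \<Lambda> v) \<bullet> d)\<bar> \<le> a * D * ?e"
    using a_pos by (simp add: abs_mult mult_ac)
  moreover have "0 \<le> a\<^sup>2 * ?e\<^sup>2" by simp
  moreover have "2 * a * D * ?e = a * D * ?e + a * D * ?e" by simp
  ultimately show ?thesis using quad unfolding increment_def by linarith
qed

lemma exponent_increment_le_1: "exponent * \<bar>increment m v d\<bar> \<le> 1"
proof -
  have "exponent * \<bar>increment m v d\<bar> \<le> exponent * (2 * D * (a * norm (clip \<Lambda> v - m)))"
    using abs_increment_le exponent_pos by (intro mult_left_mono) (auto simp: mult_ac)
  also have "\<dots> \<le> exponent * (2 * D * (8 / (1024 * l) * D))"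
    using clip_error_le exponent_pos D_pos by (intro mult_left_mono) auto
  also have "\<dots> = 16 / 1024"
    using l_ge_1 D_pos by (simp add: exponent_def power2_eq_square)
  finally show ?thesis by simp
qed

text \<open>
  The bias of clipping is removed pointwise: replacing the clipped sample by the raw one makes the
  linear term conditionally centred, and everything else, including the quadratic term of
  \<open>exp_le_quadratic\<close>, is charged to the \<open>p\<close>-th power of the noise. A positive clipping level is
  essential: for \<open>\<Lambda> = 0\<close> the linear term on the right has nothing to offset it.
\<close>
lemma exp_increment_le:
  assumes "0 < \<Lambda>"
  shows "exp (exponent * increment m v d)
      \<le> 1 + exponent * a * ((m - v) \<bullet> d) + moment_coeff * norm (v - m) powr p"
proof -
  let ?e = "norm (clip \<Lambda> v - m)" and ?N = "norm (v - m) powr p"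
  have m2: "norm m \<le> \<Lambda> / 2" using m G_le by simp
  have sq: "?e\<^sup>2 \<le> (3 / 2 * \<Lambda>) powr (2 - p) * ?N"
    using p m2 assms by (intro norm_clip_diff_sq_le_powr) auto
  have "(v - clip \<Lambda> v) \<bullet> d \<le> norm (v - clip \<Lambda> v) * norm d" by (rule norm_cauchy_schwarz)
  also have "\<dots> \<le> ((2 / \<Lambda>) powr (p - 1) * ?N) * D"
    using p m2 assms d by (intro mult_mono norm_diff_clip_le_powr) auto
  finally have "(exponent * a) * ((v - clip \<Lambda> v) \<bullet> d) \<le> (exponent * a) * (((2 / \<Lambda>) powr (p - 1) * ?N) * D)"
    using exponent_pos a_pos by (intro mult_left_mono) auto
  moreover have "(exponent * a\<^sup>2) * ?e\<^sup>2 \<le> (exponent * a\<^sup>2) * ((3 / 2 * \<Lambda>) powr (2 - p) * ?N)"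
    using exponent_pos by (intro mult_left_mono sq) auto
  moreover have "exponent * increment m v d = exponent * a * ((m - v) \<bullet> d)
      + (exponent * a) * ((v - clip \<Lambda> v) \<bullet> d) + (exponent * a\<^sup>2) * ?e\<^sup>2"
    by (simp add: increment_def inner_diff_left algebra_simps)
  moreover have "(exponent * increment m v d)\<^sup>2 \<le> 4 * (exponent * a * D)\<^sup>2 * ((3 / 2 * \<Lambda>) powr (2 - p) * ?N)"
  proof -
    have "(exponent * increment m v d)\<^sup>2 = exponent\<^sup>2 * \<bar>increment m v d\<bar>\<^sup>2" by (simp add: power_mult_distrib)
    also have "\<dots> \<le> exponent\<^sup>2 * (2 * a * D * ?e)\<^sup>2"
      using abs_increment_le by (intro mult_left_mono power_mono) auto
    also have "\<dots> = 4 * (exponent * a * D)\<^sup>2 * ?e\<^sup>2" by (simp add: power_mult_distrib)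
    also have "\<dots> \<le> 4 * (exponent * a * D)\<^sup>2 * ((3 / 2 * \<Lambda>) powr (2 - p) * ?N)"
      by (intro mult_left_mono sq) auto
    finally show ?thesis .
  qed
  moreover have "exp (exponent * increment m v d) \<le> 1 + exponent * increment m v d + (exponent * increment m v d)\<^sup>2"
  proof (rule exp_le_quadratic)
    have "exponent * increment m v d \<le> exponent * \<bar>increment m v d\<bar>"
      using exponent_pos by (intro mult_left_mono) auto
    then show "exponent * increment m v d \<le> 1" using exponent_increment_le_1 by linarith
  qed
  ultimately show ?thesis by (simp add: moment_coeff_def algebra_simps)
qed

end

lemma moment_coeff_nonneg: "0 \<le> moment_coeff"
  unfolding moment_coeff_def using exponent_pos a_pos D_pos
  by (intro add_nonneg_nonneg mult_nonneg_nonneg) auto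

text \<open>
  Over the whole phase the factors accumulate to at most \<open>exp (l / 4)\<close>. The bias is the dominant
  part and contributes \<open>5 / 32\<close> of \<open>l\<close>; the two remaining terms carry an additional factor
  \<open>a * \<Lambda> / D\<close> and are negligible.
\<close>
lemma moment_coeff_noise_le:
  assumes "0 < \<Lambda>"
  shows "moment_coeff * noise \<le> l / (4 * real T)"
proof -
  have noise: "noise \<le> \<Lambda> powr (p - 1) * (\<Delta> / (64 * D))"
    using noise_le D_pos \<Delta>_pos by (simp add: field_simps)
  have "(2 / \<Lambda>) powr (p - 1) * noise \<le> (2 / \<Lambda>) powr (p - 1) * (\<Lambda> powr (p - 1) * (\<Delta> / (64 * D)))"
    using noise by (intro mult_left_mono) auto
  also have "\<dots> = 2 powr (p - 1) * (\<Delta> / (64 * D))"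
    using assms by (simp add: powr_divide)
  also have "\<dots> \<le> 2 powr 1 * (\<Delta> / (64 * D))"
    using p D_pos \<Delta>_pos by (intro mult_right_mono powr_mono) auto
  finally have bias: "(2 / \<Lambda>) powr (p - 1) * noise \<le> \<Delta> / (32 * D)" by simp
  have half: "(3 / 2 :: real) powr (2 - p) \<le> (3 / 2) powr 1"
    using p by (intro powr_mono) auto
  have "(3 / 2 * \<Lambda>) powr (2 - p) * noise
      \<le> ((3 / 2) powr 1 * \<Lambda> powr (2 - p)) * (\<Lambda> powr (p - 1) * (\<Delta> / (64 * D)))"
    unfolding powr_mult
    using noise half noise_nonneg by (intro mult_mono) auto
  also have "\<dots> = 3 / 2 * (\<Lambda> powr (2 - p) * \<Lambda> powr (p - 1)) * (\<Delta> / (64 * D))" by simp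
  also have "\<Lambda> powr (2 - p) * \<Lambda> powr (p - 1) = \<Lambda>"
    using assms by (simp add: powr_add[symmetric])
  finally have var: "(3 / 2 * \<Lambda>) powr (2 - p) * noise \<le> 3 / 128 * (\<Lambda> * \<Delta> / D)" by simp
  have "moment_coeff * noise = exponent * a * D * ((2 / \<Lambda>) powr (p - 1) * noise)
      + (exponent * a\<^sup>2 + 4 * (exponent * a * D)\<^sup>2) * ((3 / 2 * \<Lambda>) powr (2 - p) * noise)"
    by (simp add: moment_coeff_def algebra_simps)
  also have "\<dots> \<le> exponent * a * D * (\<Delta> / (32 * D))
      + (exponent * a\<^sup>2 + 4 * (exponent * a * D)\<^sup>2) * (3 / 128 * (\<Lambda> * \<Delta> / D))"
    using bias var exponent_pos a_pos D_pos by (intro add_mono mult_left_mono) auto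
  also have "\<dots> = exponent * (a * \<Delta>) * (1 / 32 + 3 / 128 * (1 + 4 * (exponent * D\<^sup>2)) * ((a * \<Lambda>) / D))"
    using D_pos by (simp add: field_simps power2_eq_square)
  also have "exponent * D\<^sup>2 = l" using D_pos by (simp add: exponent_def)
  also have "exponent * (a * \<Delta>) * (1 / 32 + 3 / 128 * (1 + 4 * l) * ((a * \<Lambda>) / D))
      \<le> exponent * (a * \<Delta>) * (1 / 20)"
  proof (rule mult_left_mono)
    have numeric: "1 / 32 + 3 / 128 * x \<le> 1 / 20" if "x \<le> 25 / 1024" for x :: real
      using that by simp
    have "(1 + 4 * l) * (a * \<Lambda>) \<le> (5 * l) * (a * \<Lambda>)"
      using l_ge_1 a_pos \<Lambda>_nonneg by (intro mult_right_mono) auto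
    then have "1024 * ((1 + 4 * l) * (a * \<Lambda>)) \<le> 25 * D" using a_\<Lambda>_le by simp
    then have "(1 + 4 * l) * ((a * \<Lambda>) / D) \<le> 25 / 1024" using D_pos by (simp add: field_simps)
    then show "1 / 32 + 3 / 128 * (1 + 4 * l) * ((a * \<Lambda>) / D) \<le> 1 / 20"
      unfolding mult.assoc[of "3 / 128"] by (rule numeric)
  qed (use exponent_pos a_pos \<Delta>_pos in auto)
  also have "\<dots> = l / (4 * real T)" by (simp add: exponent_a)
  finally show ?thesis .
qed

end

section \<open>Sample filtration\<close>

lemma space_sample_filtration [simp]: "space (sample_filtration M S \<xi> t) = space M"
  unfolding sample_filtration_def by (rule space_measure_of) auto

lemma sets_sample_filtration:
  "sets (sample_filtration M S \<xi> t)
     = sigma_sets (space M) (\<Union>s\<in>{1..t}. {\<xi> s -` B \<inter> space M | B. B \<in> sets S})"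
  unfolding sample_filtration_def by (rule sets_measure_of) auto

lemma subalgebra_sample_filtration_mono:
  "s \<le> t \<Longrightarrow> subalgebra (sample_filtration M S \<xi> t) (sample_filtration M S \<xi> s)"
  unfolding subalgebra_def sets_sample_filtration
  by (intro conjI sigma_sets_mono') (simp, force)

lemma subalgebra_sample_filtration:
  assumes "\<And>s. 1 \<le> s \<Longrightarrow> \<xi> s \<in> measurable M S"
  shows "subalgebra M (sample_filtration M S \<xi> t)"
  unfolding subalgebra_def sets_sample_filtration
  by (intro conjI sets.sigma_sets_subset) (auto intro!: measurable_sets assms)

lemma measurable_sample_filtration:
  assumes "\<xi> s \<in> measurable M S" "1 \<le> s" "s \<le> t"
  shows "\<xi> s \<in> measurable (sample_filtration M S \<xi> t) S"
proof (rule measurableI)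
  fix B assume "B \<in> sets S"
  then show "\<xi> s -` B \<inter> space (sample_filtration M S \<xi> t) \<in> sets (sample_filtration M S \<xi> t)"
    unfolding sets_sample_filtration space_sample_filtration
    using assms by (intro sigma_sets.Basic UN_I[of s]) auto
qed (use assms(1) in \<open>auto dest: measurable_space\<close>)

section \<open>Stochastic gradients at a query of bounded gap\<close>

locale stochastic_phase =
  phase_parameters f grad \<mu> H0 H1 xstar Q w p \<sigma>0 \<sigma>1 \<sigma>2 \<rho> \<Delta> D \<Lambda> a T + prob_space M
  for f :: "'a::euclidean_space \<Rightarrow> real" and grad \<mu> H0 H1 xstar Q w p \<sigma>0 \<sigma>1 \<sigma>2 \<rho> \<Delta> D \<Lambda> a T
    and M :: "'b measure" +
  fixes S :: "'c measure" and \<xi> :: "nat \<Rightarrow> 'b \<Rightarrow> 'c" and g :: "'a \<Rightarrow> 'c \<Rightarrow> 'a"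
  assumes sampling: "stochastic_oracle M S \<xi> g f grad p \<sigma>0 \<sigma>1 \<sigma>2"
begin

abbreviation "\<F> \<equiv> sample_filtration M S \<xi>"

lemma measurable_sample: "1 \<le> t \<Longrightarrow> \<xi> t \<in> measurable M S"
  using sampling unfolding stochastic_oracle_def by blast

lemma measurable_oracle [measurable]: "(\<lambda>(x, s). g x s) \<in> borel_measurable (borel \<Otimes>\<^sub>M S)"
  using sampling unfolding stochastic_oracle_def by blast

lemma subalgebra_\<F>: "subalgebra M (\<F> t)"
  using measurable_sample by (rule subalgebra_sample_filtration)

lemma measurable_\<F>_sample: "1 \<le> s \<Longrightarrow> s \<le> t \<Longrightarrow> \<xi> s \<in> measurable (\<F> t) S"
  by (intro measurable_sample_filtration measurable_sample)

lemma measurable_\<F>_mono: "s \<le> t \<Longrightarrow> X \<in> measurable (\<F> s) N \<Longrightarrow> X \<in> measurable (\<F> t) N"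
  by (rule measurable_from_subalg[OF subalgebra_sample_filtration_mono])

context
  fixes t :: nat and x :: "'b \<Rightarrow> 'a"
  assumes x: "x \<in> borel_measurable (\<F> t)" and gap_x: "\<And>\<omega>. opt_gap f (x \<omega>) \<le> 4 * \<Delta>"
begin

abbreviation "sample_grad \<omega> \<equiv> g (x \<omega>) (\<xi> (Suc t) \<omega>)"
abbreviation "noise_power \<omega> \<equiv> norm (sample_grad \<omega> - grad (x \<omega>)) powr p"

lemma measurable_query: "x \<in> borel_measurable M"
  by (rule measurable_from_subalg[OF subalgebra_\<F> x])

lemma measurable_sample_Suc: "\<xi> (Suc t) \<in> measurable M S"
  by (rule measurable_sample) simp

lemma norm_grad_query: "norm (grad (x \<omega>)) \<le> G"
  by (rule norm_grad_le_grad_bound[OF gap_x \<Delta>_pos])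

text \<open>
  A query whose gap is bounded everywhere, and not only on an event, has conditional noise bounded
  by a constant; this is what makes all expectations below finite.
\<close>
lemma cond_noise_le:
  "AE \<omega> in M. nn_cond_exp M (\<F> t) (\<lambda>\<omega>. ennreal (noise_power \<omega>)) \<omega> \<le> ennreal noise"
proof -
  have "AE \<omega> in M. nn_cond_exp M (\<F> t) (\<lambda>\<omega>. ennreal (noise_power \<omega>)) \<omega>
      \<le> ennreal (\<sigma>0 powr p + \<sigma>1 powr p * norm (grad (x \<omega>)) powr p
                          + \<sigma>2 powr p * opt_gap f (x \<omega>) powr (p / 2))"
    using sampling x unfolding stochastic_oracle_def
    by (elim conjE allE[of _ "Suc t"]) auto
  then show ?thesis
  proof eventually_elim
    case (elim \<omega>)
    have "\<sigma>0 powr p + \<sigma>1 powr p * norm (grad (x \<omega>)) powr p + \<sigma>2 powr p * opt_gap f (x \<omega>) powr (p / 2)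
        \<le> noise"
      unfolding noise_pow_def using p norm_grad_query gap_x opt_gap_nonneg
      by (intro add_mono mult_left_mono powr_mono2[of p "norm (grad (x \<omega>))"]
            powr_mono2[of "p / 2" "opt_gap f (x \<omega>)"]) auto
    then show ?case using elim by (meson ennreal_leI order_trans)
  qed
qed

lemma
  assumes Z: "Z \<in> borel_measurable (\<F> t)" and "\<And>\<omega>. 0 \<le> Z \<omega>" and bounded: "\<And>\<omega>. Z \<omega> \<le> B"
  shows integrable_weighted_noise: "integrable M (\<lambda>\<omega>. Z \<omega> * noise_power \<omega>)"
    and weighted_noise_le: "(\<integral>\<omega>. Z \<omega> * noise_power \<omega> \<partial>M) \<le> noise * (\<integral>\<omega>. Z \<omega> \<partial>M)"
proof -
  interpret sub: finite_measure_subalgebra M "\<F> t"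
    by unfold_locales (rule subalgebra_\<F>)
  note [measurable] = measurable_query measurable_sample_Suc
  have [measurable]: "Z \<in> borel_measurable M"
    by (rule measurable_from_subalg[OF subalgebra_\<F> Z])
  have intZ: "integrable M Z"
    by (rule integrable_const_bound[of _ B]) (use assms in auto)
  have "(\<integral>\<^sup>+\<omega>. ennreal (Z \<omega> * noise_power \<omega>) \<partial>M)
      = (\<integral>\<^sup>+\<omega>. ennreal (Z \<omega>) * ennreal (noise_power \<omega>) \<partial>M)"
    using assms by (simp add: ennreal_mult)
  also have "\<dots> = (\<integral>\<^sup>+\<omega>. ennreal (Z \<omega>) * nn_cond_exp M (\<F> t) (\<lambda>\<omega>. ennreal (noise_power \<omega>)) \<omega> \<partial>M)"
    by (rule sub.nn_cond_exp_intg[symmetric]) (use Z in measurable)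
  also have "\<dots> \<le> (\<integral>\<^sup>+\<omega>. ennreal (Z \<omega>) * ennreal noise \<partial>M)"
    by (rule nn_integral_mono_AE) (use cond_noise_le in eventually_elim, auto intro: mult_left_mono)
  also have "\<dots> = ennreal (\<integral>\<omega>. Z \<omega> * noise \<partial>M)"
    using assms intZ noise_nonneg
    by (subst nn_integral_eq_integral[symmetric]) (auto simp: ennreal_mult)
  finally have le: "(\<integral>\<^sup>+\<omega>. ennreal (Z \<omega> * noise_power \<omega>) \<partial>M) \<le> ennreal (noise * (\<integral>\<omega>. Z \<omega> \<partial>M))"
    by (simp add: mult.commute)
  show int: "integrable M (\<lambda>\<omega>. Z \<omega> * noise_power \<omega>)"
    by (rule integrableI_nonneg) (use assms le in \<open>auto simp: le_less_trans[OF _ ennreal_less_top]\<close>)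
  have "ennreal (\<integral>\<omega>. Z \<omega> * noise_power \<omega> \<partial>M) \<le> ennreal (noise * (\<integral>\<omega>. Z \<omega> \<partial>M))"
    using le assms by (subst nn_integral_eq_integral[symmetric, OF int]) auto
  then show "(\<integral>\<omega>. Z \<omega> * noise_power \<omega> \<partial>M) \<le> noise * (\<integral>\<omega>. Z \<omega> \<partial>M)"
    using assms noise_nonneg by (subst (asm) ennreal_le_iff) auto
qed

lemma integrable_sample_grad: "integrable M sample_grad"
proof (rule Bochner_Integration.integrable_bound)
  note [measurable] = measurable_query measurable_sample_Suc
  show "sample_grad \<in> borel_measurable M" by measurable
  show "integrable M (\<lambda>\<omega>. 1 * noise_power \<omega> + (1 + G))"
    using integrable_weighted_noise[of "\<lambda>_. 1" 1] by simp
  show "AE \<omega> in M. norm (sample_grad \<omega>) \<le> norm (1 * noise_power \<omega> + (1 + G))"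
  proof (rule AE_I2)
    fix \<omega>
    let ?N = "norm (sample_grad \<omega> - grad (x \<omega>))"
    have "?N \<le> 1 + ?N powr p"
    proof (cases "?N \<le> 1")
      case False
      then have "?N powr 1 \<le> ?N powr p" using p by (intro powr_mono) auto
      then show ?thesis using False by simp
    qed (simp add: add_increasing2)
    moreover have "norm (sample_grad \<omega>) \<le> ?N + norm (grad (x \<omega>))"
      using norm_triangle_ineq[of "sample_grad \<omega> - grad (x \<omega>)" "grad (x \<omega>)"] by simp
    ultimately show "norm (sample_grad \<omega>) \<le> norm (1 * noise_power \<omega> + (1 + G))"
      using norm_grad_query[of \<omega>] by simp
  qed
qed

text \<open>
  The conditional mean is given coordinatewise, so the inner product is expanded in the basis and
  each coordinate of the past-measurable direction is pulled out of the conditional expectation.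
\<close>
lemma
  assumes d: "d \<in> borel_measurable (\<F> t)" and bounded: "\<And>\<omega>. norm (d \<omega>) \<le> B"
  shows integrable_noise_inner: "integrable M (\<lambda>\<omega>. (grad (x \<omega>) - sample_grad \<omega>) \<bullet> d \<omega>)"
    and noise_inner_mean_zero: "(\<integral>\<omega>. (grad (x \<omega>) - sample_grad \<omega>) \<bullet> d \<omega> \<partial>M) = 0"
proof -
  interpret sub: finite_measure_subalgebra M "\<F> t"
    by unfold_locales (rule subalgebra_\<F>)
  note [measurable] = measurable_query measurable_sample_Suc
  have [measurable]: "d \<in> borel_measurable M"
    by (rule measurable_from_subalg[OF subalgebra_\<F> d])
  have B: "\<bar>d \<omega> \<bullet> b\<bar> \<le> B" if "b \<in> Basis" for b \<omega>
    using Basis_le_norm[OF that] bounded order_trans by blast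
  have int: "integrable M (\<lambda>\<omega>. (d \<omega> \<bullet> b) * (sample_grad \<omega> \<bullet> b))" if b: "b \<in> Basis" for b
  proof (rule Bochner_Integration.integrable_bound)
    show "integrable M (\<lambda>\<omega>. B * (sample_grad \<omega> \<bullet> b))"
      using integrable_sample_grad by auto
    have "\<bar>d \<omega> \<bullet> b\<bar> * \<bar>s\<bar> \<le> \<bar>B\<bar> * \<bar>s\<bar>" for \<omega> s
      using B[OF b, of \<omega>] by (intro mult_right_mono) auto
    then show "AE \<omega> in M. norm ((d \<omega> \<bullet> b) * (sample_grad \<omega> \<bullet> b)) \<le> norm (B * (sample_grad \<omega> \<bullet> b))"
      by (auto simp: abs_mult)
  qed measurable
  let ?c = "\<lambda>b. real_cond_exp M (\<F> t) (\<lambda>\<omega>. sample_grad \<omega> \<bullet> b)"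
  have mean: "AE \<omega> in M. ?c b \<omega> = grad (x \<omega>) \<bullet> b" if "b \<in> Basis" for b
    using sampling x that unfolding stochastic_oracle_def
    by (elim conjE allE[of _ "Suc t"]) auto
  have cond: "integrable M (\<lambda>\<omega>. (d \<omega> \<bullet> b) * ?c b \<omega>)"
      "(\<integral>\<omega>. (d \<omega> \<bullet> b) * ?c b \<omega> \<partial>M) = (\<integral>\<omega>. (d \<omega> \<bullet> b) * (sample_grad \<omega> \<bullet> b) \<partial>M)"
    if b: "b \<in> Basis" for b
    using d by (auto intro!: sub.real_cond_exp_intg int b)
  have int': "integrable M (\<lambda>\<omega>. (d \<omega> \<bullet> b) * (grad (x \<omega>) \<bullet> b))" if b: "b \<in> Basis" for b
    by (rule integrable_cong_AE_imp[OF cond(1)[OF b]])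
       (measurable, use mean[OF b] in eventually_elim, simp)
  have eq: "(\<integral>\<omega>. (d \<omega> \<bullet> b) * (grad (x \<omega>) \<bullet> b) \<partial>M) = (\<integral>\<omega>. (d \<omega> \<bullet> b) * (sample_grad \<omega> \<bullet> b) \<partial>M)"
    if b: "b \<in> Basis" for b
    unfolding cond(2)[OF b, symmetric]
    by (rule integral_cong_AE[OF borel_measurable_integrable[OF int'[OF b]]
          borel_measurable_integrable[OF cond(1)[OF b]]])
       (use mean[OF b] in eventually_elim, simp)
  have sum: "(grad (x \<omega>) - sample_grad \<omega>) \<bullet> d \<omega>
      = (\<Sum>b\<in>Basis. (d \<omega> \<bullet> b) * (grad (x \<omega>) \<bullet> b) - (d \<omega> \<bullet> b) * (sample_grad \<omega> \<bullet> b))" for \<omega>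
    by (subst euclidean_inner) (simp add: inner_diff_left algebra_simps)
  show "integrable M (\<lambda>\<omega>. (grad (x \<omega>) - sample_grad \<omega>) \<bullet> d \<omega>)"
    unfolding sum using int int' by auto
  show "(\<integral>\<omega>. (grad (x \<omega>) - sample_grad \<omega>) \<bullet> d \<omega> \<partial>M) = 0"
    unfolding sum using int int' eq by (simp add: Bochner_Integration.integral_sum)
qed

end

section \<open>Stopped potential along the run\<close>

definition iterate :: "nat \<Rightarrow> 'b \<Rightarrow> 'a \<times> 'a" where
  "iterate t \<omega> = phase_iterates g Q w \<Delta> D \<Lambda> a (\<lambda>t. \<xi> t \<omega>) t"

definition query :: "nat \<Rightarrow> 'b \<Rightarrow> 'a" where
  "query t \<omega> = (A t *\<^sub>R fst (iterate t \<omega>) + a *\<^sub>R snd (iterate t \<omega>)) /\<^sub>R A (Suc t)"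

lemma iterate_0: "iterate 0 \<omega> = (w, w)"
  by (simp add: iterate_def)

lemma iterate_Suc:
  "iterate (Suc t) \<omega> =
     (let z' = closest_point Q (snd (iterate t \<omega>) - a *\<^sub>R clip \<Lambda> (g (query t \<omega>) (\<xi> (Suc t) \<omega>)))
      in ((A t *\<^sub>R fst (iterate t \<omega>) + a *\<^sub>R z') /\<^sub>R A (Suc t), z'))"
  by (simp add: iterate_def query_def Let_def split: prod.split)

lemma iterate_in_Q: "fst (iterate t \<omega>) \<in> Q \<and> snd (iterate t \<omega>) \<in> Q"
proof (induction t)
  case 0
  then show ?case by (simp add: iterate_0 w_in_Q)
next
  case (Suc t)
  have "closest_point Q v \<in> Q" for v using Q w_in_Q by (intro closest_point_in_set) auto
  then show ?case using Suc by (auto simp: iterate_Suc Let_def intro!: average_in_Q)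
qed

lemma measurable_closest_point [measurable]: "closest_point Q \<in> borel_measurable borel"
  using Q w_in_Q by (intro borel_measurable_continuous_onI continuous_on_closest_point) auto

lemma measurable_iterate:
  "(\<lambda>\<omega>. fst (iterate t \<omega>)) \<in> borel_measurable (\<F> t)"
  "(\<lambda>\<omega>. snd (iterate t \<omega>)) \<in> borel_measurable (\<F> t)"
proof (induction t)
  case 0
  { case 1 then show ?case by (simp add: iterate_0) }
  { case 2 then show ?case by (simp add: iterate_0) }
next
  case (Suc t)
  have [measurable]: "(\<lambda>\<omega>. fst (iterate t \<omega>)) \<in> borel_measurable (\<F> (Suc t))"
    "(\<lambda>\<omega>. snd (iterate t \<omega>)) \<in> borel_measurable (\<F> (Suc t))"
    "\<xi> (Suc t) \<in> measurable (\<F> (Suc t)) S"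
    by (rule measurable_\<F>_mono[OF _ Suc(1)] measurable_\<F>_mono[OF _ Suc(2)]
        measurable_\<F>_sample; simp)+
  have [measurable]: "query t \<in> borel_measurable (\<F> (Suc t))"
    unfolding query_def[abs_def] by measurable
  { case 1 show ?case unfolding iterate_Suc Let_def fst_conv by measurable }
  { case 2 show ?case unfolding iterate_Suc Let_def snd_conv by measurable }
qed

lemma measurable_query_\<F>: "query t \<in> borel_measurable (\<F> t)"
proof -
  note [measurable] = measurable_iterate[of t]
  show ?thesis unfolding query_def[abs_def]
    by measurable
qed

lemma potential_iterate_step:
  assumes "potential t (iterate t \<omega>) \<le> 3 * D\<^sup>2"
  shows "opt_gap f (query t \<omega>) \<le> 4 * \<Delta>"
    and "potential (Suc t) (iterate (Suc t) \<omega>) \<le> potential t (iterate t \<omega>)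
      + increment (grad (query t \<omega>)) (g (query t \<omega>) (\<xi> (Suc t) \<omega>)) (snd (iterate t \<omega>) - xstar)"
proof -
  obtain y z where yz: "iterate t \<omega> = (y, z)" by fastforce
  then have Qyz: "y \<in> Q" "z \<in> Q" using iterate_in_Q[of t \<omega>] by auto
  show "opt_gap f (query t \<omega>) \<le> 4 * \<Delta>"
    using query_gap[OF Qyz] assms by (simp add: query_def yz)
  show "potential (Suc t) (iterate (Suc t) \<omega>) \<le> potential t (iterate t \<omega>)
      + increment (grad (query t \<omega>)) (g (query t \<omega>) (\<xi> (Suc t) \<omega>)) (snd (iterate t \<omega>) - xstar)"
    using potential_step[OF Qyz, of t "clip \<Lambda> (g (query t \<omega>) (\<xi> (Suc t) \<omega>))"] assms
    by (simp add: iterate_Suc query_def yz Let_def increment_def)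
qed

text \<open>
  The potential, frozen at the first time at which it exceeds \<open>3 * D^2\<close>. Freezing replaces a maximal
  inequality: if the potential ever exceeds the threshold, so does the frozen process at time
  \<open>T\<close>.
\<close>
primrec stopped :: "nat \<Rightarrow> 'b \<Rightarrow> real" where
  "stopped 0 \<omega> = potential 0 (w, w)"
| "stopped (Suc t) \<omega> =
     (if stopped t \<omega> \<le> 3 * D\<^sup>2 then potential (Suc t) (iterate (Suc t) \<omega>) else stopped t \<omega>)"

lemma stopped_eq_potential:
  "stopped t \<omega> \<le> 3 * D\<^sup>2 \<Longrightarrow> stopped t \<omega> = potential t (iterate t \<omega>)"
  by (cases t) (auto simp: iterate_0 split: if_splits)

text \<open>
  After freezing, the query is replaced by the minimizer and the direction by zero. The query thereby
  has gap at most \<open>4 * \<Delta>\<close> on the whole space, as the noise bound requires, while the frozen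
  process does not see the replacement.
\<close>
definition safe_query :: "nat \<Rightarrow> 'b \<Rightarrow> 'a" where
  "safe_query t \<omega> = (if stopped t \<omega> \<le> 3 * D\<^sup>2 then query t \<omega> else xstar)"

definition direction :: "nat \<Rightarrow> 'b \<Rightarrow> 'a" where
  "direction t \<omega> = (if stopped t \<omega> \<le> 3 * D\<^sup>2 then snd (iterate t \<omega>) - xstar else 0)"

abbreviation "safe_grad t \<omega> \<equiv> g (safe_query t \<omega>) (\<xi> (Suc t) \<omega>)"

lemma safe_query_gap: "opt_gap f (safe_query t \<omega>) \<le> 4 * \<Delta>"
  using potential_iterate_step(1)[of t \<omega>] stopped_eq_potential[of t \<omega>] \<Delta>_pos
  by (simp add: safe_query_def opt_gap_xstar)

lemma safe_query_grad: "norm (grad (safe_query t \<omega>)) \<le> G"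
  by (rule norm_grad_le_grad_bound[OF safe_query_gap \<Delta>_pos])

lemma norm_direction_le: "norm (direction t \<omega>) \<le> D"
  using norm_diff_le_D[OF conjunct2[OF iterate_in_Q] xstar_in_Q] D_pos
  by (simp add: direction_def)

lemma measurable_stopped: "stopped t \<in> borel_measurable (\<F> t)"
proof (induction t)
  case 0
  then show ?case by (simp add: stopped.simps(1)[abs_def])
next
  case (Suc t)
  note [measurable] = measurable_iterate[of "Suc t"] measurable_\<F>_mono[OF le_SucI[OF order_refl] Suc]
  have [measurable]: "(\<lambda>\<omega>. potential (Suc t) (iterate (Suc t) \<omega>)) \<in> borel_measurable (\<F> (Suc t))"
    unfolding potential_def by measurable
  have "stopped (Suc t) = (\<lambda>\<omega>. if stopped t \<omega> \<le> 3 * D\<^sup>2 then potential (Suc t) (iterate (Suc t) \<omega>)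
      else stopped t \<omega>)" by (rule ext) simp
  then show ?case by simp
qed

lemma measurable_safe_query: "safe_query t \<in> borel_measurable (\<F> t)"
  and measurable_direction: "direction t \<in> borel_measurable (\<F> t)"
proof -
  note [measurable] = measurable_iterate[of t] measurable_stopped[of t] measurable_query_\<F>[of t]
  show "safe_query t \<in> borel_measurable (\<F> t)"
    unfolding safe_query_def[abs_def] by measurable
  show "direction t \<in> borel_measurable (\<F> t)"
    unfolding direction_def[abs_def] by measurable
qed

lemma stopped_Suc_le:
  "stopped (Suc t) \<omega> \<le> stopped t \<omega>
     + increment (grad (safe_query t \<omega>)) (safe_grad t \<omega>) (direction t \<omega>)"
  if "stopped t \<omega> \<le> 3 * D\<^sup>2"
  using that potential_iterate_step(2)[of t \<omega>] stopped_eq_potential[of t \<omega>]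
  by (simp add: safe_query_def direction_def)

text \<open>
  Until it is frozen the process is at most \<open>3 * D^2\<close>, and the increment that may then carry it
  over the threshold is at most \<open>D^2\<close>. Boundedness makes all exponentials integrable.
\<close>
lemma stopped_bounds: "0 \<le> stopped t \<omega> \<and> stopped t \<omega> \<le> 4 * D\<^sup>2"
proof (induction t)
  case 0
  then show ?case using potential_initial potential_nonneg[of 0 "(w, w)"] zero_le_power2[of D]
    by (simp del: zero_le_power2)
next
  case (Suc t)
  show ?case
  proof (cases "stopped t \<omega> \<le> 3 * D\<^sup>2")
    case True
    let ?i = "increment (grad (safe_query t \<omega>)) (safe_grad t \<omega>) (direction t \<omega>)"
    have "l * \<bar>?i\<bar> \<le> D\<^sup>2"
      using exponent_increment_le_1[OF safe_query_grad norm_direction_le, of t \<omega> "safe_grad t \<omega>" t \<omega>] D_pos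
      by (simp add: exponent_def field_simps)
    moreover have "1 * \<bar>?i\<bar> \<le> l * \<bar>?i\<bar>" using l_ge_1 by (intro mult_right_mono) auto
    ultimately have "?i \<le> D\<^sup>2" by linarith
    then have "stopped (Suc t) \<omega> \<le> 4 * D\<^sup>2"
      using stopped_Suc_le[OF True] True by linarith
    then show ?thesis using True potential_nonneg by simp
  qed (use Suc in simp)
qed

lemma integrable_exp_stopped: "integrable M (\<lambda>\<omega>. exp (exponent * stopped t \<omega>))"
proof (rule integrable_const_bound[of _ "exp (exponent * (4 * D\<^sup>2))"])
  have "stopped t \<in> borel_measurable M"
    by (rule measurable_from_subalg[OF subalgebra_\<F> measurable_stopped])
  then show "(\<lambda>\<omega>. exp (exponent * stopped t \<omega>)) \<in> borel_measurable M" by simp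
qed (use stopped_bounds exponent_pos in \<open>auto intro!: mult_left_mono\<close>)

lemma exp_stopped_step_pointwise:
  assumes "0 < \<Lambda>"
  shows "exp (exponent * stopped (Suc t) \<omega>) \<le> exp (exponent * stopped t \<omega>) *
     (1 + exponent * a * ((grad (safe_query t \<omega>) - safe_grad t \<omega>) \<bullet> direction t \<omega>)
        + moment_coeff * norm (safe_grad t \<omega> - grad (safe_query t \<omega>)) powr p)"
proof (cases "stopped t \<omega> \<le> 3 * D\<^sup>2")
  case True
  have "exp (exponent * stopped (Suc t) \<omega>) \<le> exp (exponent * (stopped t \<omega>
      + increment (grad (safe_query t \<omega>)) (safe_grad t \<omega>) (direction t \<omega>)))"
    using stopped_Suc_le[OF True] exponent_pos by simp
  also have "\<dots> = exp (exponent * stopped t \<omega>) *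
      exp (exponent * increment (grad (safe_query t \<omega>)) (safe_grad t \<omega>) (direction t \<omega>))"
    by (simp add: distrib_left exp_add)
  also have "\<dots> \<le> exp (exponent * stopped t \<omega>) *
     (1 + exponent * a * ((grad (safe_query t \<omega>) - safe_grad t \<omega>) \<bullet> direction t \<omega>)
        + moment_coeff * norm (safe_grad t \<omega> - grad (safe_query t \<omega>)) powr p)"
    by (intro mult_left_mono exp_increment_le safe_query_grad norm_direction_le assms) auto
  finally show ?thesis .
next
  case False
  then show ?thesis using moment_coeff_nonneg by (simp add: direction_def)
qed

text \<open>
  Integrating the pointwise bound: the weight \<open>Z\<close> and the direction are known before the sample
  is drawn, so the linear term vanishes and the noise term contributes at most
  \<open>moment_coeff * noise\<close> times the expectation of \<open>Z\<close>. If \<open>\<Lambda> = 0\<close>, then clipped samples and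
  gradients at safe queries all vanish, and the frozen process does not increase at all.
\<close>
lemma expectation_exp_stopped_step:
  "(\<integral>\<omega>. exp (exponent * stopped (Suc t) \<omega>) \<partial>M)
     \<le> exp (l / (4 * real T)) * (\<integral>\<omega>. exp (exponent * stopped t \<omega>) \<partial>M)"
proof (cases "0 < \<Lambda>")
  case True
  define Z where "Z \<omega> = exp (exponent * stopped t \<omega>)" for \<omega>
  define N where "N \<omega> = norm (safe_grad t \<omega> - grad (safe_query t \<omega>)) powr p" for \<omega>
  define X where "X \<omega> = (grad (safe_query t \<omega>) - safe_grad t \<omega>) \<bullet> (Z \<omega> *\<^sub>R direction t \<omega>)" for \<omega>
  let ?B = "exp (exponent * (4 * D\<^sup>2))"
  note [measurable] = measurable_stopped[of t] measurable_direction[of t]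
  have Z: "Z \<in> borel_measurable (\<F> t)" unfolding Z_def[abs_def] by measurable
  note [measurable] = Z
  have Zb: "0 \<le> Z \<omega>" "Z \<omega> \<le> ?B" for \<omega>
    using stopped_bounds exponent_pos by (auto simp: Z_def intro!: mult_left_mono)
  have intZ: "integrable M Z" using integrable_exp_stopped by (simp add: Z_def[abs_def])
  have Zd: "(\<lambda>\<omega>. Z \<omega> *\<^sub>R direction t \<omega>) \<in> borel_measurable (\<F> t)" by measurable
  have Zdb: "norm (Z \<omega> *\<^sub>R direction t \<omega>) \<le> ?B * D" for \<omega>
    using Zb norm_direction_le by (auto intro!: mult_mono)
  note noise_facts = measurable_safe_query safe_query_gap
  have N: "integrable M (\<lambda>\<omega>. Z \<omega> * N \<omega>)" "(\<integral>\<omega>. Z \<omega> * N \<omega> \<partial>M) \<le> noise * (\<integral>\<omega>. Z \<omega> \<partial>M)"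
    unfolding N_def
    using integrable_weighted_noise[OF noise_facts Z Zb] weighted_noise_le[OF noise_facts Z Zb]
    by auto
  have X: "integrable M X" "(\<integral>\<omega>. X \<omega> \<partial>M) = 0"
    unfolding X_def[abs_def]
    using integrable_noise_inner[OF noise_facts Zd Zdb] noise_inner_mean_zero[OF noise_facts Zd Zdb]
    by auto
  have "(\<integral>\<omega>. exp (exponent * stopped (Suc t) \<omega>) \<partial>M)
      \<le> (\<integral>\<omega>. Z \<omega> + exponent * a * X \<omega> + moment_coeff * (Z \<omega> * N \<omega>) \<partial>M)"
  proof (rule integral_mono)
    show "integrable M (\<lambda>\<omega>. Z \<omega> + exponent * a * X \<omega> + moment_coeff * (Z \<omega> * N \<omega>))"
      using intZ N X by auto
    show "exp (exponent * stopped (Suc t) \<omega>) \<le> Z \<omega> + exponent * a * X \<omega> + moment_coeff * (Z \<omega> * N \<omega>)" for \<omega>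
      using exp_stopped_step_pointwise[OF True, of t \<omega>]
      by (simp add: Z_def X_def N_def algebra_simps)
  qed (rule integrable_exp_stopped)
  also have "\<dots> = (\<integral>\<omega>. Z \<omega> \<partial>M) + moment_coeff * (\<integral>\<omega>. Z \<omega> * N \<omega> \<partial>M)"
    using intZ N X by simp
  also have "\<dots> \<le> (\<integral>\<omega>. Z \<omega> \<partial>M) + moment_coeff * (noise * (\<integral>\<omega>. Z \<omega> \<partial>M))"
    using N moment_coeff_nonneg by (intro add_left_mono mult_left_mono) auto
  also have "\<dots> = (1 + moment_coeff * noise) * (\<integral>\<omega>. Z \<omega> \<partial>M)" by (simp add: algebra_simps)
  also have "\<dots> \<le> exp (l / (4 * real T)) * (\<integral>\<omega>. Z \<omega> \<partial>M)"
  proof (intro mult_right_mono integral_nonneg)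
    show "1 + moment_coeff * noise \<le> exp (l / (4 * real T))"
      using moment_coeff_noise_le[OF True] exp_ge_add_one_self[of "l / (4 * real T)"] by linarith
  qed (use Zb in auto)
  finally show ?thesis by (simp add: Z_def)
next
  case False
  then have \<Lambda>0: "\<Lambda> = 0" using \<Lambda>_nonneg by simp
  have "stopped (Suc t) \<omega> \<le> stopped t \<omega>" for \<omega>
  proof (cases "stopped t \<omega> \<le> 3 * D\<^sup>2")
    case True
    have "norm (grad (safe_query t \<omega>)) \<le> 0" using safe_query_grad[of t \<omega>] G_le \<Lambda>0 by linarith
    then have "grad (safe_query t \<omega>) = 0" by simp
    moreover have "clip \<Lambda> v = 0" for v :: 'a using \<Lambda>0 by (simp add: clip_def)
    ultimately have "increment (grad (safe_query t \<omega>)) (safe_grad t \<omega>) (direction t \<omega>) = 0"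
      by (simp add: increment_def)
    then show ?thesis using stopped_Suc_le[OF True] by simp
  qed simp
  then have "(\<integral>\<omega>. exp (exponent * stopped (Suc t) \<omega>) \<partial>M) \<le> (\<integral>\<omega>. exp (exponent * stopped t \<omega>) \<partial>M)"
    using exponent_pos by (intro integral_mono integrable_exp_stopped) auto
  also have "\<dots> \<le> exp (l / (4 * real T)) * (\<integral>\<omega>. exp (exponent * stopped t \<omega>) \<partial>M)"
  proof -
    have "1 * (\<integral>\<omega>. exp (exponent * stopped t \<omega>) \<partial>M) \<le> exp (l / (4 * real T)) * (\<integral>\<omega>. exp (exponent * stopped t \<omega>) \<partial>M)"
      using l_ge_1 by (intro mult_right_mono integral_nonneg) auto
    then show ?thesis by simp
  qed
  finally show ?thesis by simp
qed

lemma expectation_exp_stopped_le: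
  "(\<integral>\<omega>. exp (exponent * stopped t \<omega>) \<partial>M) \<le> exp (3 / 2 * l + real t * (l / (4 * real T)))"
proof (induction t)
  case 0
  have "exponent * potential 0 (w, w) \<le> exponent * (3 / 2 * D\<^sup>2)"
    using exponent_pos potential_initial by (intro mult_left_mono) auto
  also have "\<dots> = 3 / 2 * l" using D_pos by (simp add: exponent_def)
  finally show ?case by (simp add: prob_space)
next
  case (Suc t)
  have "(\<integral>\<omega>. exp (exponent * stopped (Suc t) \<omega>) \<partial>M)
      \<le> exp (l / (4 * real T)) * (\<integral>\<omega>. exp (exponent * stopped t \<omega>) \<partial>M)"
    by (rule expectation_exp_stopped_step)
  also have "\<dots> \<le> exp (l / (4 * real T)) * exp (3 / 2 * l + real t * (l / (4 * real T)))"
    using Suc by (intro mult_left_mono) auto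
  also have "\<dots> = exp (3 / 2 * l + real (Suc t) * (l / (4 * real T)))"
    by (simp add: exp_add[symmetric] distrib_right add_divide_distrib add_ac)
  finally show ?case .
qed

section \<open>Success probability of the phase\<close>

text \<open>
  Markov's inequality for the exponential: in the exponent, the threshold exceeds the
  starting value by at least \<open>3/2 * l\<close> and the drift consumes only \<open>l / 4\<close>, leaving the factor
  \<open>exp (- 5/4 * l) \<le> \<rho> / 8\<close>.
\<close>
lemma prob_stopped_large: "prob {\<omega> \<in> space M. 3 * D\<^sup>2 < stopped T \<omega>} \<le> \<rho>"
proof -
  have [measurable]: "stopped T \<in> borel_measurable M"
    by (rule measurable_from_subalg[OF subalgebra_\<F> measurable_stopped])
  have "exponent * (3 * D\<^sup>2) = 3 * l" using D_pos by (simp add: exponent_def)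
  then have "exp (3 * l) \<le> exp (exponent * s)" if "3 * D\<^sup>2 < s" for s
    using mult_left_mono[of "3 * D\<^sup>2" s exponent] that exponent_pos by (simp only: exp_le_cancel_iff)
  then have "prob {\<omega> \<in> space M. 3 * D\<^sup>2 < stopped T \<omega>}
      \<le> prob {\<omega> \<in> space M. exp (3 * l) \<le> exp (exponent * stopped T \<omega>)}"
    by (intro finite_measure_mono) auto
  also have "\<dots> \<le> (\<integral>\<omega>. exp (exponent * stopped T \<omega>) \<partial>M) / exp (3 * l)"
    by (rule integral_Markov_inequality_measure[OF integrable_exp_stopped, of "{}"]) auto
  also have "\<dots> \<le> exp (3 / 2 * l + real T * (l / (4 * real T))) / exp (3 * l)"
    by (intro divide_right_mono expectation_exp_stopped_le) auto
  also have "\<dots> = exp (- (5 / 4 * l))"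
    using T_ge_1024 by (simp add: exp_diff[symmetric])
  also have "\<dots> \<le> exp (- l)" using l_ge_1 by simp
  also have "\<dots> = \<rho> / 8" using \<rho> by (simp add: exp_minus)
  also have "\<dots> \<le> \<rho>" using \<rho> by simp
  finally show ?thesis .
qed

lemma phase_halves_gap:
  "1 - \<rho> \<le> prob {\<omega> \<in> space M.
      opt_gap f (rcsag_phase g Q w \<Delta> D \<Lambda> T a (\<lambda>t. \<xi> t \<omega>)) \<le> \<Delta> / 2}"
proof -
  have [measurable]: "stopped T \<in> borel_measurable M"
    by (rule measurable_from_subalg[OF subalgebra_\<F> measurable_stopped])
  have [measurable]: "(\<lambda>\<omega>. fst (iterate T \<omega>)) \<in> borel_measurable M"
    by (rule measurable_from_subalg[OF subalgebra_\<F> measurable_iterate(1)])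
  have output_eq: "rcsag_phase g Q w \<Delta> D \<Lambda> T a (\<lambda>t. \<xi> t \<omega>) = fst (iterate T \<omega>)" for \<omega>
    by (simp add: rcsag_phase_def iterate_def)
  have good: "opt_gap f (fst (iterate T \<omega>)) \<le> \<Delta> / 2" if "stopped T \<omega> \<le> 3 * D\<^sup>2" for \<omega>
    using that stopped_eq_potential[OF that] opt_gap_final[of "fst (iterate T \<omega>)" "snd (iterate T \<omega>)"]
    by simp
  have "prob {\<omega> \<in> space M. stopped T \<omega> \<le> 3 * D\<^sup>2} = 1 - prob {\<omega> \<in> space M. 3 * D\<^sup>2 < stopped T \<omega>}"
    by (subst prob_compl[symmetric]) (auto intro!: arg_cong[of _ _ prob])
  then have "1 - \<rho> \<le> prob {\<omega> \<in> space M. stopped T \<omega> \<le> 3 * D\<^sup>2}"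
    using prob_stopped_large by simp
  also have "\<dots> \<le> prob {\<omega> \<in> space M. opt_gap f (fst (iterate T \<omega>)) \<le> \<Delta> / 2}"
    using good by (intro finite_measure_mono) auto
  finally show ?thesis by (simp add: output_eq)
qed

end

theorem theorem8:
  fixes f :: "'a::euclidean_space \<Rightarrow> real"
    and grad :: "'a \<Rightarrow> 'a"
    and g :: "'a \<Rightarrow> 'c \<Rightarrow> 'a"
    and M :: "'b measure"
    and S :: "'c measure"
    and \<xi> :: "nat \<Rightarrow> 'b \<Rightarrow> 'c"
    and Q :: "'a set"
    and w xstar :: 'a
    and \<mu> H0 H1 p \<sigma>0 \<sigma>1 \<sigma>2 \<rho> \<Delta> D \<Lambda> a :: real
    and T :: nat
  assumes "prob_space M"
    and minimizer: "\<forall>x. f xstar \<le> f x"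
    and A: "convex_differentiable f grad \<mu>"
    and B: "H_smooth f grad H0 H1"
    and C: "stochastic_oracle M S \<xi> g f grad p \<sigma>0 \<sigma>1 \<sigma>2"
    and "0 < \<rho>" "\<rho> < 1" "0 < \<Delta>"
    and "closed Q" "convex Q" "w \<in> Q" "xstar \<in> Q"
    and "bounded Q" and D: "D = diameter Q" "0 < D"
    and "opt_gap f w \<le> \<Delta>"
    and \<Lambda>: "\<Lambda> = clip_level H0 H1 p \<sigma>0 \<sigma>1 \<sigma>2 \<Delta> D"
    and T: "T = phase_length \<Lambda> \<Delta> D \<rho>"
    and a: "a = phase_step \<Delta> D T"
  shows "measure M {\<omega> \<in> space M.
           opt_gap f (rcsag_phase g Q w \<Delta> D \<Lambda> T a (\<lambda>t. \<xi> t \<omega>)) \<le> \<Delta> / 2} \<ge> 1 - \<rho>"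
proof -
  interpret prob_space M by fact
  interpret stochastic_phase f grad \<mu> H0 H1 xstar Q w p \<sigma>0 \<sigma>1 \<sigma>2 \<rho> \<Delta> D \<Lambda> a T M S \<xi> g
  proof unfold_locales
    show "1 < p" "p \<le> 2" using C by (simp_all add: stochastic_oracle_def)
  qed (use assms in blast)+
  show ?thesis by (rule phase_halves_gap)
qed

end
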